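(* Let $f:\mathbb{R}^{d_x}\to\mathbb{R}$ be convex and $L_f$-smooth for some $L_f>0$, let $g:\mathbb{R}^{d_x}\to\mathbb{R}$ be $L_g$-smooth and $\mu_g$-strongly convex for some $L_g\ge\mu_g>0$, let $\mathsf{K}:\mathbb{R}^{d_x}\to\mathbb{R}^{d_y}$ be a nonzero linear operator with operator norm $\|\mathsf{K}\|$ and $$\lambda_{\min}^+(\mathsf{K}\mathsf{K}^* ):=\inf_{u\in\mathrm{ran}(\mathsf{K})\setminus\{0\}}\frac{\|\mathsf{K}^*u\|^2}{\|u\|^2}>0,$$ and let $b\in\mathrm{ran}(\mathsf{K})$. Let $(x^\star,y^\star,z^\star)$ satisfy $$0=\nabla g(x^\star)+\mathsf{K}^*y^\star+\nabla f(z^\star),\quad y^\star\in\mathrm{ran}(\mathsf{K}),\quad\mathsf{K}x^\star=b,\quad z^\star=x^\star.$$ Then $(x^\star,y^\star,z^\star)$ is the unique triple satisfying these conditions. Moreover, let $$\eta_x=\min\left\{\frac1{\sqrt{L_f\mu_g}},\sqrt{\frac{\lambda^+_{\min}(\mathsf{K}\mathsf{K}^* )}{\|\mathsf{K}\|^2}}\cdot\frac1{\sqrt{(L_g+L_f)\mu_g}}\right\},\quad\eta_y=\frac1{8\|\mathsf{K}\|^2\eta_x},\quad\eta_z=\frac1{8L_f\eta_x},$$ let $(x^k,y^k,z^k)_{k\ge0}$ be generated by any one of the four algorithms ACV-I, ACV-II, APDTR-I, APDTR-II with these stepsizes, started from $(x^0,y^0,z^0)$ with $y^0\in\mathrm{ran}(\mathsf{K})$,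 and define $$\Psi_k=\frac1{2\eta_x}\|x^k-x^\star\|^2+\frac1{2\eta_y}\|y^k-y^\star\|^2+\frac1{\eta_z}D_f(z^k;z^\star)+s_1\langle y^k-y^\star,\mathsf{K}(x^k-x^\star)\rangle+s_2\langle\nabla f(z^k)-\nabla f(z^\star),x^k-x^\star\rangle,$$ where $(s_1,s_2)=(-1,-1)$ for ACV-I, $(+1,-1)$ for ACV-II, $(-1,+1)$ for APDTR-I and $(+1,+1)$ for APDTR-II. Then for any $\varepsilon>0$ the number of iterations needed to achieve $\Psi_k\le\varepsilon\Psi_0$ is $$\mathcal{O}\left(\left(\sqrt{\frac{L_f+L_g}{\mu_g}}\cdot\frac{\|\mathsf{K}\|}{\sqrt{\lambda^+_{\min}(\mathsf{K}\mathsf{K}^* )}}+\frac{\|\mathsf{K}\|^2}{\lambda^+_{\min}(\mathsf{K}\mathsf{K}^* )}\right)\log\frac1\varepsilon\right),$$ i.e. there is an absolute constant $C>0$ (independent of the problem data, the dimensions, the initial point and $\varepsilon$) such that $\Psi_k\le\varepsilon\Psi_0$ for every integer $k\ge0$ that is at least $C$ times the expression inside $\mathcal{O}(\cdot)$.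
   Context: The underlying problem is $\min_x f(x)+g(x)$ subject to $\mathsf{K}x=b$, i.e. $\min_x f(x)+g(x)+h(\mathsf{K}x)$ with $h$ the indicator function of $\{b\}$, whose conjugate is $h^*(y)=\langle y,b\rangle$. A function $\phi$ is $\mu$-strongly convex ($\mu\ge0$; $\mu=0$ means convex) if $\phi(x)\ge\phi(y)+\langle p,x-y\rangle+\frac{\mu}{2}\|x-y\|^2$ for all $x,y$ and all $p\in\partial\phi(y)$. A differentiable $\phi$ is $L$-smooth if $\nabla\phi$ is $L$-Lipschitz. $D_f(x;y)=f(x)-f(y)-\langle\nabla f(y),x-y\rangle$. $\mathrm{prox}_F(v)=\arg\min_w\{F(w)+\frac12\|w-v\|^2\}$. $\mathsf{K}^*$ is the adjoint and $\mathrm{ran}(\mathsf{K})$ the range of $\mathsf{K}$. Each algorithm, for $k=0,1,2,\dots$, performs in the order listed: ACV-I: $x^{k+1}=\mathrm{prox}_{\eta_xg}(x^k-\eta_x\mathsf{K}^*y^k-\eta_x\nabla f(z^k))$; $y^{k+1}=y^k+\eta_y(\mathsf{K}(2x^{k+1}-x^k)-b)$; $z^{k+1}=\frac1{1+\eta_z}z^k+\frac{\eta_z}{1+\eta_z}(2x^{k+1}-x^k)$. ACV-II: $y^{k+1}=y^k+\eta_y(\mathsf{K}x^k-b)$; $x^{k+1}=\mathrm{prox}_{\eta_xg}(x^k-\eta_x\mathsf{K}^*(2y^{k+1}-y^k)-\eta_x\nabla f(z^k))$; $z^{k+1}=\frac1{1+\eta_z}z^k+\frac{\eta_z}{1+\eta_z}(2x^{k+1}-x^k)$.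 APDTR-I: $z^{k+1}=\frac1{1+\eta_z}z^k+\frac{\eta_z}{1+\eta_z}x^k$; $x^{k+1}=\mathrm{prox}_{\eta_xg}(x^k-\eta_x\mathsf{K}^*y^k-\eta_x(2\nabla f(z^{k+1})-\nabla f(z^k)))$; $y^{k+1}=y^k+\eta_y(\mathsf{K}(2x^{k+1}-x^k)-b)$. APDTR-II: $y^{k+1}=y^k+\eta_y(\mathsf{K}x^k-b)$; $z^{k+1}=\frac1{1+\eta_z}z^k+\frac{\eta_z}{1+\eta_z}x^k$; $x^{k+1}=\mathrm{prox}_{\eta_xg}(x^k-\eta_x\mathsf{K}^*(2y^{k+1}-y^k)-\eta_x(2\nabla f(z^{k+1})-\nabla f(z^k)))$. *)

theory Defs
  imports "HOL-Analysis.Analysis"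
begin

section \<open>Euclidean spaces with the dimension as a term\<close>

text \<open>
  The complexity constant must not depend on the dimensions, so these have to be quantified
  inside the existential quantifier over the constant and cannot be type parameters.
  The type \<open>fseq\<close> of finitely supported real sequences is an inner product space
  containing every $\mathbb{R}^n$ as the coordinate subspace \<open>Rn n\<close>.
\<close>

typedef fseq = "{x :: nat \<Rightarrow> real. finite {i. x i \<noteq> 0}}"
  morphisms coord Abs_fseq
  by (rule exI[of _ "\<lambda>_. 0"]) simp

setup_lifting type_definition_fseq

lemma fseq_eqI: "(\<And>i. coord x i = coord y i) \<Longrightarrow> x = y"
  by transfer auto

lemma finite_support: "finite {i. coord x i \<noteq> 0}"
  using coord[of x] by simp

instantiation fseq :: real_vector
begin

lift_definition zero_fseq :: fseq is "\<lambda>_. 0" by simp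

lift_definition plus_fseq :: "fseq \<Rightarrow> fseq \<Rightarrow> fseq" is "\<lambda>x y i. x i + y i"
  subgoal for x y
    by (rule finite_subset[of _ "{i. x i \<noteq> 0} \<union> {i. y i \<noteq> 0}"]) auto
  done

lift_definition uminus_fseq :: "fseq \<Rightarrow> fseq" is "\<lambda>x i. - x i" by simp

lift_definition minus_fseq :: "fseq \<Rightarrow> fseq \<Rightarrow> fseq" is "\<lambda>x y i. x i - y i"
  subgoal for x y
    by (rule finite_subset[of _ "{i. x i \<noteq> 0} \<union> {i. y i \<noteq> 0}"]) auto
  done

lift_definition scaleR_fseq :: "real \<Rightarrow> fseq \<Rightarrow> fseq" is "\<lambda>c x i. c * x i"
  subgoal for c x
    by (rule finite_subset[of _ "{i. x i \<noteq> 0}"]) auto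
  done

instance
  by standard (transfer; auto simp: fun_eq_iff algebra_simps)+

end

lemma coord_simps [simp]:
  "coord 0 i = 0"
  "coord (x + y) i = coord x i + coord y i"
  "coord (x - y) i = coord x i - coord y i"
  "coord (- x) i = - coord x i"
  "coord (c *\<^sub>R x) i = c * coord x i"
  by (transfer; simp)+

instantiation fseq :: real_inner
begin

definition inner_fseq :: "fseq \<Rightarrow> fseq \<Rightarrow> real"
  where "inner_fseq x y = (\<Sum>i | coord x i \<noteq> 0. coord x i * coord y i)"

definition norm_fseq :: "fseq \<Rightarrow> real"
  where "norm_fseq x = sqrt (inner x x)"

definition dist_fseq :: "fseq \<Rightarrow> fseq \<Rightarrow> real"
  where "dist_fseq x y = norm (x - y)"

definition sgn_fseq :: "fseq \<Rightarrow> fseq"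
  where "sgn_fseq x = x /\<^sub>R norm x"

definition uniformity_fseq :: "(fseq \<times> fseq) filter"
  where "uniformity_fseq = (INF e\<in>{0<..}. principal {(x, y). dist x y < e})"

definition open_fseq :: "fseq set \<Rightarrow> bool"
  where "open_fseq U \<longleftrightarrow> (\<forall>x\<in>U. \<forall>\<^sub>F (x', y) in uniformity. x' = x \<longrightarrow> y \<in> U)"

instance
proof
  have inner_sum: "inner x y = (\<Sum>i\<in>A. coord x i * coord y i)"
    if "finite A" "{i. coord x i \<noteq> 0} \<subseteq> A" for x y :: fseq and A
    unfolding inner_fseq_def by (rule sum.mono_neutral_left) (use that in auto)
  fix x y z :: fseq and r :: real
  let ?A = "{i. coord x i \<noteq> 0} \<union> {i. coord y i \<noteq> 0}"
  have fin: "finite ?A" by (simp add: finite_support)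
  have xy: "inner x y = (\<Sum>i\<in>?A. coord x i * coord y i)"
    by (rule inner_sum) (use fin in auto)
  moreover have "inner y x = (\<Sum>i\<in>?A. coord y i * coord x i)"
    by (rule inner_sum) (use fin in auto)
  ultimately show "inner x y = inner y x"
    by (simp add: mult.commute)
  have "inner (x + y) z = (\<Sum>i\<in>?A. coord (x + y) i * coord z i)"
    by (rule inner_sum) (use fin in auto)
  moreover have "inner x z = (\<Sum>i\<in>?A. coord x i * coord z i)"
    by (rule inner_sum) (use fin in auto)
  moreover have "inner y z = (\<Sum>i\<in>?A. coord y i * coord z i)"
    by (rule inner_sum) (use fin in auto)
  ultimately show "inner (x + y) z = inner x z + inner y z"
    by (simp add: algebra_simps sum.distrib)
  have "inner (r *\<^sub>R x) y = (\<Sum>i\<in>?A. coord (r *\<^sub>R x) i * coord y i)"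
    by (rule inner_sum) (use fin in auto)
  then show "inner (r *\<^sub>R x) y = r * inner x y"
    using xy by (simp add: sum_distrib_left mult.assoc)
  show "0 \<le> inner x x"
    by (simp add: inner_fseq_def sum_nonneg)
  show "inner x x = 0 \<longleftrightarrow> x = 0"
  proof
    assume "inner x x = 0"
    then have "\<forall>i\<in>{i. coord x i \<noteq> 0}. coord x i * coord x i = 0"
      unfolding inner_fseq_def by (subst (asm) sum_nonneg_eq_0_iff) (auto simp: finite_support)
    then show "x = 0" by (intro fseq_eqI) auto
  qed (simp add: inner_fseq_def)
qed (simp_all add: norm_fseq_def dist_fseq_def sgn_fseq_def uniformity_fseq_def open_fseq_def)

end

definition Rn :: "nat \<Rightarrow> fseq set"
  where "Rn n = {x. \<forall>i\<ge>n. coord x i = 0}"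

lemma subspace_Rn: "subspace (Rn n)"
  by (auto simp: subspace_def Rn_def)

lemma inner_Rn: "x \<in> Rn n \<Longrightarrow> x \<bullet> y = (\<Sum>i<n. coord x i * coord y i)"
  unfolding inner_fseq_def
  by (rule sum.mono_neutral_left) (auto simp: Rn_def not_less[symmetric])

text \<open>
  A linear operator $\mathbb{R}^m \to \mathbb{R}^n$ is represented by its extension that vanishes on the
  orthogonal complement of \<open>Rn m\<close>. This changes neither range nor operator norm, and makes
  the adjoint on \<open>fseq\<close> exist and map into \<open>Rn m\<close>, so \<^const>\<open>range\<close>,
  \<^const>\<open>onorm\<close> and \<^const>\<open>adjoint\<close> have their usual meaning.
\<close>

definition lin_ops :: "nat \<Rightarrow> nat \<Rightarrow> (fseq \<Rightarrow> fseq) set"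
  where "lin_ops m n =
    {K. linear K \<and> range K \<subseteq> Rn n \<and> (\<forall>x. (\<forall>i<m. coord x i = 0) \<longrightarrow> K x = 0)}"

lift_definition unit_vec :: "nat \<Rightarrow> fseq" is "\<lambda>i j. if j = i then 1 else 0" by simp

lemma coord_unit_vec [simp]: "coord (unit_vec i) j = (if j = i then 1 else 0)"
  by transfer simp

lemma coord_sum [simp]: "coord (sum F A) i = (\<Sum>a\<in>A. coord (F a) i)"
  by (induction A rule: infinite_finite_induct) auto

lemma unit_vec_Rn: "i < n \<Longrightarrow> unit_vec i \<in> Rn n"
  by (auto simp: Rn_def)

lemma inner_unit_vec [simp]: "unit_vec i \<bullet> x = coord x i" "x \<bullet> unit_vec i = coord x i"
proof -
  show *: "unit_vec i \<bullet> x = coord x i"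
    by (simp add: inner_fseq_def)
  show "x \<bullet> unit_vec i = coord x i"
    using * by (simp add: inner_commute)
qed

lemma lin_ops_expand:
  assumes "K \<in> lin_ops m n"
  shows "K x = (\<Sum>i<m. coord x i *\<^sub>R K (unit_vec i))"
proof -
  have lin: "linear K" using assms by (simp add: lin_ops_def)
  let ?s = "\<Sum>i<m. coord x i *\<^sub>R unit_vec i"
  have "K (x - ?s) = 0"
  proof -
    have "coord (x - ?s) j = 0" if "j < m" for j
    proof -
      have "(\<Sum>i<m. coord x i * (if j = i then 1 else 0)) = coord x j"
        using that by (subst sum.remove[of _ j]) auto
      then show ?thesis by simp
    qed
    then show ?thesis using assms unfolding lin_ops_def by blast
  qed
  then have "K x = K ?s"
    using lin by (simp add: linear_diff)
  also have "\<dots> = (\<Sum>i<m. coord x i *\<^sub>R K (unit_vec i))"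
    using lin by (simp add: linear_sum linear_scale)
  finally show ?thesis .
qed

lemma bounded_linear_lin_ops: "K \<in> lin_ops m n \<Longrightarrow> bounded_linear K"
proof -
  assume K: "K \<in> lin_ops m n"
  have "bounded_linear (\<lambda>x. \<Sum>i<m. (x \<bullet> unit_vec i) *\<^sub>R K (unit_vec i))"
    by (intro bounded_linear_sum bounded_linear_scaleR_const bounded_linear_inner_left)
  moreover have "K = (\<lambda>x. \<Sum>i<m. (x \<bullet> unit_vec i) *\<^sub>R K (unit_vec i))"
  proof
    fix x show "K x = (\<Sum>i<m. (x \<bullet> unit_vec i) *\<^sub>R K (unit_vec i))"
      unfolding lin_ops_expand[OF K, of x] by simp
  qed
  ultimately show "bounded_linear K" by metis
qed

lemma adjoint_lin_ops:
  assumes "K \<in> lin_ops m n"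
  shows "K x \<bullet> y = x \<bullet> adjoint K y" and "adjoint K y \<in> Rn m"
proof -
  let ?A = "\<lambda>y. \<Sum>i<m. (K (unit_vec i) \<bullet> y) *\<^sub>R unit_vec i"
  have *: "K x \<bullet> y = x \<bullet> ?A y" for x y
    unfolding lin_ops_expand[OF assms, of x]
    by (simp add: inner_sum_left inner_sum_right mult.commute)
  then have adj: "adjoint K = ?A"
    by (intro adjoint_unique) blast
  show "K x \<bullet> y = x \<bullet> adjoint K y"
    unfolding adj by (rule *)
  show "adjoint K y \<in> Rn m"
    unfolding adj by (intro subspace_sum subspace_scale subspace_Rn unit_vec_Rn) simp
qed

definition lambda_min_pos :: "('a::real_inner \<Rightarrow> 'b::real_inner) \<Rightarrow> real"
  where "lambda_min_pos K = (INF u \<in> range K - {0}. (norm (adjoint K u))\<^sup>2 / (norm u)\<^sup>2)"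


section \<open>Convex analysis on a subspace\<close>

text \<open>
  Below, \<open>X\<close> is the domain space (\<open>Rn d\<close> in the application); values of
  functions outside \<open>X\<close> are irrelevant.
\<close>

definition gradient :: "'a::real_inner set \<Rightarrow> ('a \<Rightarrow> real) \<Rightarrow> 'a \<Rightarrow> 'a"
  where "gradient X \<phi> x = (THE p. p \<in> X \<and> (\<phi> has_derivative (\<lambda>h. h \<bullet> p)) (at x within X))"

lemma gradient_eqI:
  fixes X :: "'a::real_inner set"
  assumes X: "subspace X" "x \<in> X" "p \<in> X"
    and p: "(\<phi> has_derivative (\<lambda>h. h \<bullet> p)) (at x within X)"
  shows "gradient X \<phi> x = p"
  unfolding gradient_def
proof (rule the_equality)
  show "p \<in> X \<and> (\<phi> has_derivative (\<lambda>h. h \<bullet> p)) (at x within X)"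
    using X p by blast
next
  fix q assume q: "q \<in> X \<and> (\<phi> has_derivative (\<lambda>h. h \<bullet> q)) (at x within X)"
  let ?l = "\<lambda>t::real. x + t *\<^sub>R (q - p)"
  have sub: "range ?l \<subseteq> X"
    using X q by (auto intro!: subspace_add subspace_scale subspace_diff)
  have l: "(?l has_derivative (\<lambda>t. t *\<^sub>R (q - p))) (at 0)"
    by (auto intro!: derivative_eq_intros)
  have "((\<phi> \<circ> ?l) has_derivative ((\<lambda>h. h \<bullet> r) \<circ> (\<lambda>t. t *\<^sub>R (q - p)))) (at 0)"
    if "(\<phi> has_derivative (\<lambda>h. h \<bullet> r)) (at x within X)" for r
    by (rule diff_chain_within) (use l that sub in \<open>auto intro: has_derivative_subset\<close>)
  from this[of p] this[of q] p q
  have "(\<lambda>h. h \<bullet> p) \<circ> (\<lambda>t. t *\<^sub>R (q - p)) = (\<lambda>h. h \<bullet> q) \<circ> (\<lambda>t::real. t *\<^sub>R (q - p))"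
    using has_derivative_unique by blast
  then have "(q - p) \<bullet> p = (q - p) \<bullet> q"
    by (auto dest: fun_cong[of _ _ 1])
  then have "(q - p) \<bullet> (q - p) = 0"
    by (simp add: inner_diff_right)
  then show "q = p" by simp
qed

definition smooth_on :: "'a::real_inner set \<Rightarrow> real \<Rightarrow> ('a \<Rightarrow> real) \<Rightarrow> bool"
  where "smooth_on X L \<phi> \<longleftrightarrow> \<phi> differentiable_on X \<and> L-lipschitz_on X (gradient X \<phi>)"

definition subdifferential :: "'a::real_inner set \<Rightarrow> ('a \<Rightarrow> real) \<Rightarrow> 'a \<Rightarrow> 'a set"
  where "subdifferential X \<phi> y = {p \<in> X. \<forall>x\<in>X. \<phi> x \<ge> \<phi> y + p \<bullet> (x - y)}"

text \<open>
  Convexity is required explicitly: at a point with empty subdifferential the inequality is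
  vacuous, so without it a concave function, say, would qualify.
\<close>

definition strongly_convex_on :: "'a::real_inner set \<Rightarrow> real \<Rightarrow> ('a \<Rightarrow> real) \<Rightarrow> bool"
  where "strongly_convex_on X \<mu> \<phi> \<longleftrightarrow> convex_on X \<phi> \<and>
    (\<forall>x\<in>X. \<forall>y\<in>X. \<forall>p\<in>subdifferential X \<phi> y.
      \<phi> x \<ge> \<phi> y + p \<bullet> (x - y) + \<mu> / 2 * (norm (x - y))\<^sup>2)"

definition bregman :: "'a::real_inner set \<Rightarrow> ('a \<Rightarrow> real) \<Rightarrow> 'a \<Rightarrow> 'a \<Rightarrow> real"
  where "bregman X \<phi> x y = \<phi> x - \<phi> y - gradient X \<phi> y \<bullet> (x - y)"

text \<open>\<open>is_prox X F v w\<close> reads $w = \mathrm{prox}_F(v)$.\<close>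

definition is_prox :: "'a::real_inner set \<Rightarrow> ('a \<Rightarrow> real) \<Rightarrow> 'a \<Rightarrow> 'a \<Rightarrow> bool"
  where "is_prox X F v w \<longleftrightarrow>
    is_arg_min (\<lambda>u. F u + 1 / 2 * (norm (u - v))\<^sup>2) (\<lambda>u. u \<in> X) w"


section \<open>The algorithms\<close>

definition optimality_system ::
  "'a::real_inner set \<Rightarrow> ('a \<Rightarrow> real) \<Rightarrow> ('a \<Rightarrow> real) \<Rightarrow> ('a \<Rightarrow> 'b::real_inner) \<Rightarrow> 'b
    \<Rightarrow> 'a \<Rightarrow> 'b \<Rightarrow> 'a \<Rightarrow> bool"
  where "optimality_system X f g K b x y z \<longleftrightarrow>
    x \<in> X \<and> z \<in> X \<and>
    0 = gradient X g x + adjoint K y + gradient X f z \<and>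
    y \<in> range K \<and> K x = b \<and> z = x"

datatype algorithm = ACV_I | ACV_II | APDTR_I | APDTR_II

fun generated_by ::
  "algorithm \<Rightarrow> 'a::real_inner set \<Rightarrow> ('a \<Rightarrow> real) \<Rightarrow> ('a \<Rightarrow> real)
    \<Rightarrow> ('a \<Rightarrow> 'b::real_inner) \<Rightarrow> 'b \<Rightarrow> real \<Rightarrow> real \<Rightarrow> real
    \<Rightarrow> (nat \<Rightarrow> 'a) \<Rightarrow> (nat \<Rightarrow> 'b) \<Rightarrow> (nat \<Rightarrow> 'a) \<Rightarrow> bool"
where
  "generated_by ACV_I X f g K b \<eta>\<^sub>x \<eta>\<^sub>y \<eta>\<^sub>z x y z \<longleftrightarrow> (\<forall>k.
     is_prox X (\<lambda>w. \<eta>\<^sub>x * g w)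
       (x k - \<eta>\<^sub>x *\<^sub>R adjoint K (y k) - \<eta>\<^sub>x *\<^sub>R gradient X f (z k)) (x (Suc k)) \<and>
     y (Suc k) = y k + \<eta>\<^sub>y *\<^sub>R (K (2 *\<^sub>R x (Suc k) - x k) - b) \<and>
     z (Suc k) = (1 / (1 + \<eta>\<^sub>z)) *\<^sub>R z k + (\<eta>\<^sub>z / (1 + \<eta>\<^sub>z)) *\<^sub>R (2 *\<^sub>R x (Suc k) - x k))"
| "generated_by ACV_II X f g K b \<eta>\<^sub>x \<eta>\<^sub>y \<eta>\<^sub>z x y z \<longleftrightarrow> (\<forall>k.
     y (Suc k) = y k + \<eta>\<^sub>y *\<^sub>R (K (x k) - b) \<and>
     is_prox X (\<lambda>w. \<eta>\<^sub>x * g w)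
       (x k - \<eta>\<^sub>x *\<^sub>R adjoint K (2 *\<^sub>R y (Suc k) - y k) - \<eta>\<^sub>x *\<^sub>R gradient X f (z k)) (x (Suc k)) \<and>
     z (Suc k) = (1 / (1 + \<eta>\<^sub>z)) *\<^sub>R z k + (\<eta>\<^sub>z / (1 + \<eta>\<^sub>z)) *\<^sub>R (2 *\<^sub>R x (Suc k) - x k))"
| "generated_by APDTR_I X f g K b \<eta>\<^sub>x \<eta>\<^sub>y \<eta>\<^sub>z x y z \<longleftrightarrow> (\<forall>k.
     z (Suc k) = (1 / (1 + \<eta>\<^sub>z)) *\<^sub>R z k + (\<eta>\<^sub>z / (1 + \<eta>\<^sub>z)) *\<^sub>R x k \<and>
     is_prox X (\<lambda>w. \<eta>\<^sub>x * g w)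
       (x k - \<eta>\<^sub>x *\<^sub>R adjoint K (y k)
         - \<eta>\<^sub>x *\<^sub>R (2 *\<^sub>R gradient X f (z (Suc k)) - gradient X f (z k))) (x (Suc k)) \<and>
     y (Suc k) = y k + \<eta>\<^sub>y *\<^sub>R (K (2 *\<^sub>R x (Suc k) - x k) - b))"
| "generated_by APDTR_II X f g K b \<eta>\<^sub>x \<eta>\<^sub>y \<eta>\<^sub>z x y z \<longleftrightarrow> (\<forall>k.
     y (Suc k) = y k + \<eta>\<^sub>y *\<^sub>R (K (x k) - b) \<and>
     z (Suc k) = (1 / (1 + \<eta>\<^sub>z)) *\<^sub>R z k + (\<eta>\<^sub>z / (1 + \<eta>\<^sub>z)) *\<^sub>R x k \<and>
     is_prox X (\<lambda>w. \<eta>\<^sub>x * g w)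
       (x k - \<eta>\<^sub>x *\<^sub>R adjoint K (2 *\<^sub>R y (Suc k) - y k)
         - \<eta>\<^sub>x *\<^sub>R (2 *\<^sub>R gradient X f (z (Suc k)) - gradient X f (z k))) (x (Suc k)))"

fun sign_y :: "algorithm \<Rightarrow> real" where
  "sign_y ACV_I = -1"
| "sign_y ACV_II = 1"
| "sign_y APDTR_I = -1"
| "sign_y APDTR_II = 1"

fun sign_z :: "algorithm \<Rightarrow> real" where
  "sign_z ACV_I = -1"
| "sign_z ACV_II = -1"
| "sign_z APDTR_I = 1"
| "sign_z APDTR_II = 1"

definition lyapunov ::
  "algorithm \<Rightarrow> 'a::real_inner set \<Rightarrow> ('a \<Rightarrow> real) \<Rightarrow> ('a \<Rightarrow> 'b::real_inner)
    \<Rightarrow> real \<Rightarrow> real \<Rightarrow> real \<Rightarrow> 'a \<Rightarrow> 'b \<Rightarrow> 'a \<Rightarrow> 'a \<Rightarrow> 'b \<Rightarrow> 'a \<Rightarrow> real"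
  where "lyapunov alg X f K \<eta>\<^sub>x \<eta>\<^sub>y \<eta>\<^sub>z xs ys zs x y z =
    1 / (2 * \<eta>\<^sub>x) * (norm (x - xs))\<^sup>2 + 1 / (2 * \<eta>\<^sub>y) * (norm (y - ys))\<^sup>2
    + 1 / \<eta>\<^sub>z * bregman X f z zs
    + sign_y alg * ((y - ys) \<bullet> K (x - xs))
    + sign_z alg * ((gradient X f z - gradient X f zs) \<bullet> (x - xs))"

end

theory Submission
  imports Defs
begin

text \<open>
  With $s = s_1$ and $s' = s_2$ all four algorithms are instances of one scheme: the primal step uses
  $y^{k+1} + s\,(y^{k+1} - y^k)$ and $\nabla f(z^{k+1}) + s'(\nabla f(z^{k+1}) - \nabla f(z^k))$, the
  $y$- and $z$-steps use $x^{k+1} - s\,(x^{k+1} - x^k)$ and $x^{k+1} - s'(x^{k+1} - x^k)$.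
  Pairing the three update equations with the new errors gives an exact identity
  $\Psi_{k+1} = \Psi_k - E_k$. Here $E_k$ controls the squared increments,
  $\mu_g \|x^{k+1}-x^\star\|^2$, the Bregman distance of $z^{k+1}$, and, by cocoercivity, the squared
  gradient differences of $f$ and $g$. It contains no term in $y^{k+1}-y^\star$; but the $x$-update
  expresses $\mathsf{K}^*(y^{k+1}-y^\star)$ through the quantities controlled by $E_k$, and
  $\mathsf{K}^*$ is bounded below on $\mathrm{ran}(\mathsf{K})$. Hence $\Psi_{k+1} \le 120\,R\,E_k$, where
  $R$ is the expression in the complexity bound, and $\Psi$ decays geometrically.
\<close>

section \<open>Gradients on coordinate subspaces\<close>

text \<open>The definite description behind \<open>gradient\<close> is usable only once a
  representing vector exists. In finitely many coordinates it is assembled from the derivatives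
  along the unit vectors, and \<open>gradient_eqI\<close> identifies it with
  \<open>gradient\<close>.\<close>

lemma gradient_Rn:
  assumes "\<phi> differentiable_on Rn d" and x: "x \<in> Rn d"
  shows "gradient (Rn d) \<phi> x \<in> Rn d"
    and "(\<phi> has_derivative (\<lambda>h. h \<bullet> gradient (Rn d) \<phi> x)) (at x within Rn d)"
proof -
  from assms obtain D where D: "(\<phi> has_derivative D) (at x within Rn d)"
    by (auto simp: differentiable_on_def differentiable_def)
  then have lin: "linear D" by (simp add: has_derivative_linear)
  define p where "p = (\<Sum>i<d. D (unit_vec i) *\<^sub>R unit_vec i)"
  have p: "p \<in> Rn d"
    unfolding p_def by (intro subspace_sum subspace_scale subspace_Rn unit_vec_Rn) simp
  have Dp: "D h = h \<bullet> p" if "h \<in> Rn d" for h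
  proof -
    have "h = (\<Sum>i<d. coord h i *\<^sub>R unit_vec i)"
    proof (rule fseq_eqI)
      fix j
      show "coord h j = coord (\<Sum>i<d. coord h i *\<^sub>R unit_vec i) j"
        using that by (simp add: Rn_def if_distrib[of "(*) _"] cong: if_cong)
    qed
    then have "D h = D (\<Sum>i<d. coord h i *\<^sub>R unit_vec i)" by simp
    also have "\<dots> = (\<Sum>i<d. coord h i * D (unit_vec i))"
      by (simp add: linear_sum[OF lin] linear_scale[OF lin])
    also have "\<dots> = h \<bullet> p"
      by (simp add: p_def inner_sum_right mult.commute)
    finally show ?thesis .
  qed
  \<comment> \<open>Off \<open>Rn d\<close> the map \<open>D\<close> may differ from the inner
    product with \<open>p\<close>, but the limit within \<open>Rn d\<close> only tests increments
    \<open>y - x\<close> in \<open>Rn d\<close>.\<close>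
  have "(\<phi> has_derivative (\<lambda>h. h \<bullet> p)) (at x within Rn d)"
    unfolding has_derivative_within
  proof
    show "bounded_linear (\<lambda>h. h \<bullet> p)" by (rule bounded_linear_inner_left)
    have "((\<lambda>y. (1 / norm (y - x)) *\<^sub>R (\<phi> y - (\<phi> x + D (y - x)))) \<longlongrightarrow> 0) (at x within Rn d)"
      using D by (simp add: has_derivative_within)
    then show "((\<lambda>y. (1 / norm (y - x)) *\<^sub>R (\<phi> y - (\<phi> x + (y - x) \<bullet> p))) \<longlongrightarrow> 0) (at x within Rn d)"
      by (rule Lim_transform_within[of _ _ _ _ 1])
        (auto simp: Dp subspace_diff[OF subspace_Rn] x)
  qed
  with gradient_eqI[OF subspace_Rn x p this] p
  show "gradient (Rn d) \<phi> x \<in> Rn d"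
    and "(\<phi> has_derivative (\<lambda>h. h \<bullet> gradient (Rn d) \<phi> x)) (at x within Rn d)"
    by simp_all
qed

section \<open>Smooth convex functions and their Bregman distances\<close>

locale smooth_convex =
  fixes X :: "'a::real_inner set" and \<phi> :: "'a \<Rightarrow> real" and G :: "'a \<Rightarrow> 'a" and L :: real
  assumes subspace: "subspace X"
    and G_mem: "x \<in> X \<Longrightarrow> G x \<in> X"
    and deriv: "x \<in> X \<Longrightarrow> (\<phi> has_derivative (\<lambda>h. h \<bullet> G x)) (at x within X)"
    and convex: "convex_on X \<phi>"
    and lipschitz: "L-lipschitz_on X G"
    and L_pos: "L > 0"
begin

definition D :: "'a \<Rightarrow> 'a \<Rightarrow> real"
  where "D x y = \<phi> x - \<phi> y - G y \<bullet> (x - y)"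

lemma line_mem: "x \<in> X \<Longrightarrow> h \<in> X \<Longrightarrow> x + t *\<^sub>R h \<in> X"
  by (intro subspace_add subspace_scale subspace)

lemma deriv_line:
  assumes "x \<in> X" "h \<in> X"
  shows "((\<lambda>t. \<phi> (x + t *\<^sub>R h)) has_real_derivative h \<bullet> G (x + t *\<^sub>R h)) (at t)"
proof -
  have l: "((\<lambda>t. x + t *\<^sub>R h) has_derivative (\<lambda>t. t *\<^sub>R h)) (at t)"
    by (auto intro!: derivative_eq_intros)
  have "((\<phi> \<circ> (\<lambda>t. x + t *\<^sub>R h)) has_derivative
      ((\<lambda>k. k \<bullet> G (x + t *\<^sub>R h)) \<circ> (\<lambda>t. t *\<^sub>R h))) (at t)"
    by (rule diff_chain_within[OF l has_derivative_subset[OF deriv]])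
      (use assms line_mem in auto)
  then show ?thesis
    by (simp add: has_field_derivative_def o_def mult_commute_abs)
qed

text \<open>Restriction to the line through \<open>y\<close> and \<open>x\<close> reduces this to
  the tangent inequality for convex functions of one real variable.\<close>

lemma D_nonneg:
  assumes "x \<in> X" "y \<in> X"
  shows "0 \<le> D x y"
proof -
  let ?h = "x - y"
  have h: "?h \<in> X" using assms subspace by (simp add: subspace_diff)
  have "convex_on UNIV (\<lambda>t. \<phi> (y + t *\<^sub>R ?h))"
  proof (rule convex_onI)
    fix t a b :: real assume t: "0 < t" "t < 1"
    have "y + ((1 - t) *\<^sub>R a + t *\<^sub>R b) *\<^sub>R ?h
        = (1 - t) *\<^sub>R (y + a *\<^sub>R ?h) + t *\<^sub>R (y + b *\<^sub>R ?h)"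
      by (simp add: algebra_simps)
    then show "\<phi> (y + ((1 - t) *\<^sub>R a + t *\<^sub>R b) *\<^sub>R ?h)
        \<le> (1 - t) * \<phi> (y + a *\<^sub>R ?h) + t * \<phi> (y + b *\<^sub>R ?h)"
      using convex_onD[OF convex, of t "y + a *\<^sub>R ?h" "y + b *\<^sub>R ?h"] t line_mem[OF assms(2) h]
      by simp
  qed simp
  from convex_on_imp_above_tangent[OF this, of 0 1 "?h \<bullet> G y"] deriv_line[OF assms(2) h, of 0]
  show ?thesis by (simp add: D_def inner_commute)
qed

text \<open>The descent lemma: along the segment, subtracting the tangent and the quadratic leaves a
  function whose derivative is nonpositive by Cauchy-Schwarz and the Lipschitz bound.\<close>

lemma D_upper:
  assumes "x \<in> X" "y \<in> X"
  shows "D x y \<le> L / 2 * (norm (x - y))\<^sup>2"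
proof -
  let ?h = "x - y"
  have h: "?h \<in> X" using assms subspace by (simp add: subspace_diff)
  let ?w = "\<lambda>t. \<phi> (y + t *\<^sub>R ?h) - t * (?h \<bullet> G y) - L / 2 * t\<^sup>2 * (norm ?h)\<^sup>2"
  have "?w 1 \<le> ?w 0"
  proof (rule DERIV_nonpos_imp_nonincreasing[of 0 1 ?w])
    fix t :: real assume t: "0 \<le> t" "t \<le> 1"
    let ?d = "?h \<bullet> G (y + t *\<^sub>R ?h) - ?h \<bullet> G y - L * t * (norm ?h)\<^sup>2"
    have "(?w has_real_derivative ?d) (at t)"
      by (rule derivative_eq_intros deriv_line assms h refl | simp)+
    moreover have "?h \<bullet> (G (y + t *\<^sub>R ?h) - G y) \<le> norm ?h * norm (G (y + t *\<^sub>R ?h) - G y)"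
      by (rule norm_cauchy_schwarz)
    moreover have "norm (G (y + t *\<^sub>R ?h) - G y) \<le> L * (t * norm ?h)"
      using lipschitz_onD[OF lipschitz line_mem[OF assms(2) h] assms(2), of t] t
      by (simp add: dist_norm)
    then have "norm ?h * norm (G (y + t *\<^sub>R ?h) - G y) \<le> norm ?h * (L * (t * norm ?h))"
      by (rule mult_left_mono) simp
    ultimately show "\<exists>d. (?w has_real_derivative d) (at t) \<and> d \<le> 0"
      by (intro exI[of _ ?d]) (simp add: inner_diff_right power2_eq_square mult_ac)
  qed simp
  then show ?thesis by (simp add: D_def inner_commute)
qed

text \<open>The map sending \<open>u\<close> to \<open>D u y\<close> has gradient
  \<open>G x - G y\<close> at \<open>x\<close> and is nonnegative, so a gradient step of length
  \<open>1 / L\<close> from \<open>x\<close> cannot push it below 0; \<open>D_upper\<close>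
  quantifies the descent along this step.\<close>

lemma D_lower:
  assumes "x \<in> X" "y \<in> X"
  shows "(norm (G x - G y))\<^sup>2 / (2 * L) \<le> D x y"
proof -
  let ?r = "G x - G y"
  let ?w = "x - (1 / L) *\<^sub>R ?r"
  have w: "?w \<in> X"
    by (intro subspace_diff subspace_scale subspace assms G_mem)
  have "norm (?w - x) = norm ?r / L"
    using L_pos by simp
  then have "D ?w x \<le> (norm ?r)\<^sup>2 / (2 * L)"
    using D_upper[OF w assms(1)] L_pos by (simp only: power_divide) (simp add: power2_eq_square)
  moreover have "D ?w y = D x y + D ?w x - (1 / L) * (?r \<bullet> ?r)"
    by (simp add: D_def algebra_simps inner_diff_left inner_diff_right inner_commute
        diff_divide_distrib add_divide_distrib)
  ultimately show ?thesis
    using D_nonneg[OF w assms(2)] by (simp add: dot_square_norm field_simps)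
qed

lemma three_point: "(x - y) \<bullet> (G x - G z) = D x z - D y z + D y x"
  by (simp add: D_def algebra_simps inner_diff_left inner_diff_right inner_commute)

lemma D_sym: "(x - y) \<bullet> (G x - G y) = D x y + D y x"
  using three_point[of x y y] by (simp add: D_def)

end

lemma smooth_convex_Rn:
  assumes "smooth_on (Rn d) L \<phi>" "convex_on (Rn d) \<phi>" "L > 0"
  shows "smooth_convex (Rn d) \<phi> (gradient (Rn d) \<phi>) L"
  using assms gradient_Rn by unfold_locales (auto simp: smooth_on_def subspace_Rn)

text \<open>Strong convexity is formulated through subgradients; \<open>D_nonneg\<close> shows that
  \<open>G y\<close> is one of them.\<close>

lemma (in smooth_convex) strongly_convex_D:
  assumes sc: "strongly_convex_on X \<mu> \<phi>" and "x \<in> X" "y \<in> X"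
  shows "\<mu> / 2 * (norm (x - y))\<^sup>2 \<le> D x y"
proof -
  have "G y \<in> subdifferential X \<phi> y"
    using D_nonneg[of _ y] assms(3) G_mem by (auto simp: subdifferential_def D_def algebra_simps)
  then have "\<phi> x \<ge> \<phi> y + G y \<bullet> (x - y) + \<mu> / 2 * (norm (x - y))\<^sup>2"
    using assms unfolding strongly_convex_on_def by blast
  then show ?thesis by (simp add: D_def)
qed

text \<open>Fermat's rule tested in a single direction, the residual \<open>r\<close> of the claimed
  equation: the directional derivative is the squared norm of \<open>r\<close> and vanishes at a
  minimizer. Since \<open>v\<close> lies in \<open>X\<close>, so does \<open>r\<close>.\<close>

lemma (in smooth_convex) is_prox_eq:
  assumes p: "is_prox X (\<lambda>w. \<eta> * \<phi> w) v w" and v: "v \<in> X"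
  shows "w \<in> X" and "v - w = \<eta> *\<^sub>R G w"
proof -
  show w: "w \<in> X" using p by (simp add: is_prox_def is_arg_min_def)
  define r where "r = \<eta> *\<^sub>R G w + (w - v)"
  have r: "r \<in> X" unfolding r_def
    by (intro subspace_add subspace_scale subspace_diff subspace G_mem v w)
  let ?q = "\<lambda>t. \<eta> * \<phi> (w + t *\<^sub>R r) + 1 / 2 * ((w + t *\<^sub>R r - v) \<bullet> (w + t *\<^sub>R r - v))"
  have "(?q has_real_derivative \<eta> * (r \<bullet> G w) + 1 / 2 * (2 * (r \<bullet> (w - v)))) (at 0)"
  proof (intro DERIV_add DERIV_cmult)
    show "((\<lambda>t. \<phi> (w + t *\<^sub>R r)) has_real_derivative r \<bullet> G w) (at 0)"
      using deriv_line[OF w r, of 0] by simp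
    have "(\<lambda>t. (w + t *\<^sub>R r - v) \<bullet> (w + t *\<^sub>R r - v))
        = (\<lambda>t. (w - v) \<bullet> (w - v) + t * (2 * (r \<bullet> (w - v))) + t\<^sup>2 * (r \<bullet> r))"
      by (simp add: fun_eq_iff inner_simps inner_commute algebra_simps power2_eq_square)
    moreover have "((\<lambda>t. (w - v) \<bullet> (w - v) + t * (2 * (r \<bullet> (w - v))) + t\<^sup>2 * (r \<bullet> r))
        has_real_derivative 2 * (r \<bullet> (w - v))) (at 0)"
      by (auto intro!: derivative_eq_intros)
    ultimately show "((\<lambda>t. (w + t *\<^sub>R r - v) \<bullet> (w + t *\<^sub>R r - v))
        has_real_derivative 2 * (r \<bullet> (w - v))) (at 0)"
      by simp
  qed
  moreover have "?q 0 \<le> ?q t" for t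
    using p line_mem[OF w r, of t] unfolding is_prox_def is_arg_min_linorder
    by (auto simp: dot_square_norm)
  ultimately have "\<eta> * (r \<bullet> G w) + 1 / 2 * (2 * (r \<bullet> (w - v))) = 0"
    using DERIV_local_min[of ?q _ 0 1] by auto
  then have "r \<bullet> (\<eta> *\<^sub>R G w + (w - v)) = 0"
    unfolding inner_add_right inner_scaleR_right by simp
  then have "r = 0"
    unfolding r_def[symmetric] by simp
  then show "v - w = \<eta> *\<^sub>R G w"
    unfolding r_def by (simp add: algebra_simps)
qed

section \<open>One step of the scheme in abstract error variables\<close>

text \<open>The weights are tuned to \<open>c\<close> being the primal stepsize: two cross terms
  bounded this way consume 1/8 + 1/8 of \<open>1 / c\<close> times a squared primal norm, half of
  the coefficient 1/2 present in the energy.\<close>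

lemma scaled_young:
  fixes a b c :: real
  assumes "c > 0"
  shows "a * b \<le> b\<^sup>2 / (8 * c) + 2 * c * a\<^sup>2"
proof -
  have "0 \<le> (b - 4 * c * a)\<^sup>2 / (8 * c)" using assms by simp
  also have "\<dots> = b\<^sup>2 / (8 * c) + 2 * c * a\<^sup>2 - a * b"
    using assms by (simp add: field_simps power2_eq_square)
  finally show ?thesis by simp
qed

text \<open>The difference of the two sides is the sum of all squared pairwise distances.\<close>

lemma norm_sum5_sq:
  fixes a b c d e :: "'a::real_inner"
  shows "(norm (a + b + c + d + e))\<^sup>2
    \<le> 5 * ((norm a)\<^sup>2 + (norm b)\<^sup>2 + (norm c)\<^sup>2 + (norm d)\<^sup>2 + (norm e)\<^sup>2)"
proof -
  have "0 \<le> (norm (a-b))\<^sup>2 + (norm (a-c))\<^sup>2 + (norm (a-d))\<^sup>2 + (norm (a-e))\<^sup>2 + (norm (b-c))\<^sup>2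
    + (norm (b-d))\<^sup>2 + (norm (b-e))\<^sup>2 + (norm (c-d))\<^sup>2 + (norm (c-e))\<^sup>2 + (norm (d-e))\<^sup>2"
    by simp
  then show ?thesis
    unfolding power2_norm_eq_inner by (simp add: inner_simps inner_commute)
qed

text \<open>Plain and primed letters are errors before and after a step; \<open>v\<close> is the
  gradient error of the smooth term \<open>f\<close>, \<open>G\<close> that of \<open>g\<close> at
  the new point. \<open>D\<close>, \<open>D'\<close> and \<open>E\<close> stand for the Bregman
  distances of the old \<open>z\<close> and the new \<open>z\<close> to the solution, and of the old
  \<open>z\<close> to the new one. Each update is divided by its stepsize and paired with the new
  error.\<close>

lemma energy_identity:
  fixes x x' z z' G v v' :: "'a::real_inner" and y y' :: "'b::real_inner"
  assumes lin: "linear K" and adj: "\<And>x y. K x \<bullet> y = x \<bullet> T y"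
    and pos: "\<eta>\<^sub>x > 0" "\<eta>\<^sub>y > 0" "\<eta>\<^sub>z > 0"
    and X: "x - x' = \<eta>\<^sub>x *\<^sub>R (T (y' + s *\<^sub>R (y' - y)) + (v' + s' *\<^sub>R (v' - v)) + G)"
    and Y: "y' - y = \<eta>\<^sub>y *\<^sub>R K (x' - s *\<^sub>R (x' - x))"
    and Z: "z' - z = \<eta>\<^sub>z *\<^sub>R (x' - s' *\<^sub>R (x' - x) - z')"
    and D: "(z' - z) \<bullet> v' = D' - D + E"
  shows "1 / (2 * \<eta>\<^sub>x) * (norm x')\<^sup>2 + 1 / (2 * \<eta>\<^sub>y) * (norm y')\<^sup>2 + 1 / \<eta>\<^sub>z * D'
      + s * (y' \<bullet> K x') + s' * (v' \<bullet> x')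
    = 1 / (2 * \<eta>\<^sub>x) * (norm x)\<^sup>2 + 1 / (2 * \<eta>\<^sub>y) * (norm y)\<^sup>2 + 1 / \<eta>\<^sub>z * D
      + s * (y \<bullet> K x) + s' * (v \<bullet> x)
      - (1 / (2 * \<eta>\<^sub>x) * (norm (x' - x))\<^sup>2 + 1 / (2 * \<eta>\<^sub>y) * (norm (y' - y))\<^sup>2 + 1 / \<eta>\<^sub>z * E
        + s * ((y' - y) \<bullet> K (x' - x)) + s' * ((v' - v) \<bullet> (x' - x)) + G \<bullet> x' + v' \<bullet> z')"
proof -
  note Ks = linear_diff[OF lin] linear_scale[OF lin]
  have polar: "2 * ((u - w) \<bullet> w) = (norm u)\<^sup>2 - (norm w)\<^sup>2 - (norm (w - u))\<^sup>2"
    "2 * ((w - u) \<bullet> w) = (norm w)\<^sup>2 - (norm u)\<^sup>2 + (norm (w - u))\<^sup>2" for u w :: "'c::real_inner"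
    by (simp_all add: power2_norm_eq_inner inner_diff_left inner_diff_right inner_commute)
  have "1 / (2 * \<eta>\<^sub>x) * (2 * ((x - x') \<bullet> x')) = (y' + s *\<^sub>R (y' - y)) \<bullet> K x'
      + (v' + s' *\<^sub>R (v' - v)) \<bullet> x' + G \<bullet> x'"
    using pos adj[of x' "y' + s *\<^sub>R (y' - y)"] unfolding X
    by (simp add: inner_add_left inner_add_right inner_commute)
  moreover have "1 / (2 * \<eta>\<^sub>y) * (2 * ((y' - y) \<bullet> y')) = y' \<bullet> K (x' - s *\<^sub>R (x' - x))"
    using pos unfolding Y by (simp add: inner_commute)
  moreover have "1 / \<eta>\<^sub>z * (D' - D + E) = v' \<bullet> (x' - s' *\<^sub>R (x' - x)) - v' \<bullet> z'"
    using pos unfolding D[symmetric] Z by (simp add: inner_commute inner_diff_right)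
  \<comment> \<open>The extrapolations in the two paired updates carry opposite signs, so the mixed
    terms reduce to a telescoping cross term plus a product of increments. The next equation does
    the same for \<open>v\<close> and \<open>x\<close>.\<close>
  moreover have "(y' + s *\<^sub>R (y' - y)) \<bullet> K x' - y' \<bullet> K (x' - s *\<^sub>R (x' - x))
      = s * (y' \<bullet> K x') - s * (y \<bullet> K x) + s * ((y' - y) \<bullet> K (x' - x))"
    unfolding Ks by (simp add: inner_add_left inner_diff_left inner_diff_right algebra_simps)
  moreover have "(v' + s' *\<^sub>R (v' - v)) \<bullet> x' - v' \<bullet> (x' - s' *\<^sub>R (x' - x))
      = s' * (v' \<bullet> x') - s' * (v \<bullet> x) + s' * ((v' - v) \<bullet> (x' - x))"
    by (simp add: inner_add_left inner_diff_left inner_diff_right algebra_simps)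
  ultimately show ?thesis
    unfolding polar right_diff_distrib distrib_left by linarith
qed

text \<open>The scalar core of \<open>energy_decrease\<close>: \<open>a\<close>, \<open>b\<close>,
  \<open>c\<close> are squared increments of \<open>x\<close>, of \<open>y\<close> (times the
  squared operator norm) and of the gradient of \<open>f\<close>; \<open>p\<close>,
  \<open>q\<close>, \<open>r\<close>, \<open>w\<close> are the squared new errors of
  \<open>x\<close>, of \<open>y\<close> (scaled likewise) and of the gradients of \<open>f\<close>
  and \<open>g\<close>. \<open>B\<close> is the squared condition ratio, and the hypothesis on
  \<open>q\<close> recovers the dual error from the other quantities.\<close>

lemma rate_estimate:
  fixes \<eta> \<mu> L\<^sub>f L\<^sub>g A B a b c p q r w D :: real
  assumes pos: "\<eta> > 0" "\<mu> > 0" "L\<^sub>f > 0" "L\<^sub>g > 0" "A > 0" "B \<ge> 1"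
    and A: "\<eta> * \<mu> * A = 1" "\<mu> * A\<^sup>2 = (L\<^sub>f + L\<^sub>g) * B"
    and nonneg: "0 \<le> a" "0 \<le> b" "0 \<le> c" "0 \<le> p" "0 \<le> r" "0 \<le> w" "0 \<le> D"
    and q: "q \<le> 5 * B * (a / \<eta>\<^sup>2 + b + c + r + w)"
  shows "3 / (4 * \<eta>) * p + 6 * \<eta> * q + 12 * (L\<^sub>f * \<eta>) * D
    \<le> 120 * (A + B) * (a / (4 * \<eta>) + 2 * \<eta> * b + 2 * \<eta> * c + \<mu> / 2 * p + w / (2 * L\<^sub>g) + D
        + r / (2 * L\<^sub>f))"
proof -
  have inv: "1 / \<eta> = \<mu> * A" using A(1) pos by (simp add: field_simps)
  \<comment> \<open>The stepsize balances the terms: \<open>B * \<eta>\<close> times either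
    smoothness constant is at most \<open>A\<close>, which pays for the gradient errors
    \<open>r\<close> and \<open>w\<close>.\<close>
  have "B * \<eta> * (L\<^sub>f + L\<^sub>g) = \<eta> * (\<mu> * A\<^sup>2)" using A(2) by (simp add: mult_ac)
  also have "\<dots> = A" using A(1) by (simp add: power2_eq_square mult.assoc[symmetric])
  finally have BA: "B * \<eta> * L\<^sub>f + B * \<eta> * L\<^sub>g = A" by (simp add: algebra_simps)
  have "0 < B * \<eta> * L\<^sub>f" "0 < B * \<eta> * L\<^sub>g" using pos by auto
  with BA have Bf: "B * \<eta> * L\<^sub>f \<le> A" and Bg: "B * \<eta> * L\<^sub>g \<le> A" by linarith+
  have "L\<^sub>f * \<eta> * 1 \<le> L\<^sub>f * \<eta> * B" using pos by (intro mult_left_mono) auto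
  with Bf have Lf: "L\<^sub>f * \<eta> \<le> A" by (simp add: mult_ac)
  \<comment> \<open>The constant 120 is forced by the primal increment:
    \<open>6 * \<eta> * 5 * B * a / \<eta>\<^sup>2\<close> equals
    \<open>120 * B * (a / (4 * \<eta>))\<close>. The other terms need at most 60.\<close>
  define R where "R = 120 * (A + B)"
  have R: "120 * A \<le> R" "120 * B \<le> R" using pos by (auto simp: R_def)
  have 1: "3 / (4 * \<eta>) * p \<le> R * (\<mu> / 2 * p)"
  proof -
    have "3 / (4 * \<eta>) * p = 3 / 4 * (\<mu> * A) * p" unfolding inv[symmetric] by simp
    also have "\<dots> = (3 / 2 * A) * (\<mu> / 2 * p)" by simp
    also have "\<dots> \<le> R * (\<mu> / 2 * p)" using R pos nonneg by (intro mult_right_mono) auto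
    finally show ?thesis .
  qed
  have 2: "12 * (L\<^sub>f * \<eta>) * D \<le> R * D"
    using R Lf pos nonneg by (intro mult_right_mono) auto
  have "6 * \<eta> * q \<le> 6 * \<eta> * (5 * B * (a / \<eta>\<^sup>2 + b + c + r + w))"
    using q pos by (intro mult_left_mono) auto
  also have "\<dots> = 120 * B * (a / (4 * \<eta>)) + 15 * B * (2 * \<eta> * b) + 15 * B * (2 * \<eta> * c)
      + 30 * (B * \<eta>) * r + 30 * (B * \<eta>) * w"
    using pos by (simp add: distrib_left power2_eq_square)
  also have "\<dots> \<le> R * (a / (4 * \<eta>)) + R * (2 * \<eta> * b) + R * (2 * \<eta> * c)
      + R * (r / (2 * L\<^sub>f)) + R * (w / (2 * L\<^sub>g))"
  proof (intro add_mono)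
    have "30 * (B * \<eta>) * r = 60 * (B * \<eta> * L\<^sub>f) * (r / (2 * L\<^sub>f))" using pos by simp
    also have "\<dots> \<le> R * (r / (2 * L\<^sub>f))"
      using Bf R pos nonneg by (intro mult_right_mono) auto
    finally show "30 * (B * \<eta>) * r \<le> R * (r / (2 * L\<^sub>f))" .
    have "30 * (B * \<eta>) * w = 60 * (B * \<eta> * L\<^sub>g) * (w / (2 * L\<^sub>g))" using pos by simp
    also have "\<dots> \<le> R * (w / (2 * L\<^sub>g))"
      using Bg R pos nonneg by (intro mult_right_mono) auto
    finally show "30 * (B * \<eta>) * w \<le> R * (w / (2 * L\<^sub>g))" .
    show "120 * B * (a / (4 * \<eta>)) \<le> R * (a / (4 * \<eta>))"
      using R pos nonneg by (intro mult_right_mono) auto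
    show "15 * B * (2 * \<eta> * b) \<le> R * (2 * \<eta> * b)" "15 * B * (2 * \<eta> * c) \<le> R * (2 * \<eta> * c)"
      using R pos nonneg by (intro mult_right_mono; simp)+
  qed
  finally show ?thesis
    using 1 2 unfolding R_def[symmetric] distrib_left[of R] by linarith
qed

lemma signed_inner_bounds:
  assumes "\<bar>s\<bar> = 1"
  shows "\<bar>s * (u \<bullet> w)\<bar> \<le> norm u * norm (w :: 'a::real_inner)"
  using assms Cauchy_Schwarz_ineq2[of u w] by (simp add: abs_mult)

text \<open>The decrease \<open>?E\<close> is bounded below and the new energy \<open>?P\<close>
  above by the same squared quantities, except that the dual error occurs only in \<open>?P\<close>.
  Coercivity of \<open>T\<close> at \<open>y'\<close> supplies it, and \<open>rate_estimate\<close>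
  compares the two bounds.\<close>

lemma energy_decrease:
  fixes x x' z' G v v' :: "'a::real_inner" and y y' :: "'b::real_inner"
  assumes lin: "linear T"
    and K_bound: "\<And>u. norm (K u) \<le> N * norm u" and T_bound: "\<And>u. norm (T u) \<le> N * norm u"
    and coercive: "\<kappa> * (norm y')\<^sup>2 \<le> (norm (T y'))\<^sup>2"
    and pos: "\<eta> > 0" "\<mu> > 0" "L\<^sub>f > 0" "L\<^sub>g > 0" "A > 0" "N > 0" "\<kappa> > 0" "\<kappa> \<le> N\<^sup>2"
    and A: "\<eta> * \<mu> * A = 1" "\<mu> * A\<^sup>2 = (L\<^sub>f + L\<^sub>g) * (N\<^sup>2 / \<kappa>)"
    and \<eta>\<^sub>y: "\<eta>\<^sub>y = 1 / (8 * N\<^sup>2 * \<eta>)" and \<eta>\<^sub>z: "\<eta>\<^sub>z = 1 / (8 * L\<^sub>f * \<eta>)"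
    and s: "\<bar>s\<bar> = 1" "\<bar>s'\<bar> = 1"
    and X: "x - x' = \<eta> *\<^sub>R (T (y' + s *\<^sub>R (y' - y)) + (v' + s' *\<^sub>R (v' - v)) + G)"
    and D': "(norm v')\<^sup>2 / (2 * L\<^sub>f) \<le> D'" and E: "(norm (v' - v))\<^sup>2 / (2 * L\<^sub>f) \<le> E"
    and z': "D' + (norm v')\<^sup>2 / (2 * L\<^sub>f) \<le> v' \<bullet> z'"
    and G: "\<mu> / 2 * (norm x')\<^sup>2 + (norm G)\<^sup>2 / (2 * L\<^sub>g) \<le> G \<bullet> x'"
  shows "1 / (2 * \<eta>) * (norm x')\<^sup>2 + 1 / (2 * \<eta>\<^sub>y) * (norm y')\<^sup>2 + 1 / \<eta>\<^sub>z * D'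
      + s * (y' \<bullet> K x') + s' * (v' \<bullet> x')
    \<le> 120 * (A + N\<^sup>2 / \<kappa>)
      * (1 / (2 * \<eta>) * (norm (x' - x))\<^sup>2 + 1 / (2 * \<eta>\<^sub>y) * (norm (y' - y))\<^sup>2 + 1 / \<eta>\<^sub>z * E
        + s * ((y' - y) \<bullet> K (x' - x)) + s' * ((v' - v) \<bullet> (x' - x)) + G \<bullet> x' + v' \<bullet> z')"
    (is "?P \<le> _ * ?E")
    and "0 \<le> 1 / (2 * \<eta>) * (norm x')\<^sup>2 + 1 / (2 * \<eta>\<^sub>y) * (norm y')\<^sup>2 + 1 / \<eta>\<^sub>z * D'
      + s * (y' \<bullet> K x') + s' * (v' \<bullet> x')"
proof -
  have coupling: "\<bar>s * (u \<bullet> K w)\<bar> \<le> 1 / 8 * (1 / \<eta> * (norm w)\<^sup>2) + 2 * \<eta> * (N\<^sup>2 * (norm u)\<^sup>2)"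
    for u w
  proof -
    have "\<bar>s * (u \<bullet> K w)\<bar> \<le> norm u * (N * norm w)"
      using signed_inner_bounds[OF s(1), of u "K w"] mult_left_mono[OF K_bound[of w], of "norm u"]
      by simp
    then show ?thesis
      using scaled_young[OF pos(1), of "N * norm u" "norm w"] by (simp add: power_mult_distrib mult_ac)
  qed
  have coupling': "\<bar>s' * (u \<bullet> w)\<bar> \<le> 1 / 8 * (1 / \<eta> * (norm w)\<^sup>2) + 2 * \<eta> * (norm u)\<^sup>2" for u w :: 'a
    using signed_inner_bounds[OF s(2), of u w] scaled_young[OF pos(1), of "norm u" "norm w"]
    by simp
  \<comment> \<open>The factors 8 in the stepsizes give the increments of \<open>y\<close> and
    \<open>v\<close> a weight 4, twice what the Young bounds on the cross terms take away.\<close>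
  have steps: "1 / (2 * \<eta>\<^sub>y) = 4 * (\<eta> * N\<^sup>2)" "1 / \<eta>\<^sub>z = 8 * (\<eta> * L\<^sub>f)"
    by (simp_all add: \<eta>\<^sub>y \<eta>\<^sub>z)
  have halves: "1 / (2 * \<eta>) * q = 1 / 2 * (1 / \<eta> * q)" "q / (4 * \<eta>) = 1 / 4 * (1 / \<eta> * q)"
    "3 / (4 * \<eta>) * q = 3 / 4 * (1 / \<eta> * q)" for q
    by simp_all
  have E': "4 * \<eta> * (norm (v' - v))\<^sup>2 \<le> 1 / \<eta>\<^sub>z * E"
    using mult_left_mono[OF E, of "8 * \<eta> * L\<^sub>f"] pos unfolding steps by (simp add: mult_ac)
  have D'': "4 * \<eta> * (norm v')\<^sup>2 \<le> 8 * (\<eta> * L\<^sub>f) * D'"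
    using mult_left_mono[OF D', of "8 * \<eta> * L\<^sub>f"] pos by (simp add: mult_ac)
  have E_lower: "(norm (x' - x))\<^sup>2 / (4 * \<eta>) + 2 * \<eta> * (N\<^sup>2 * (norm (y' - y))\<^sup>2)
      + 2 * \<eta> * (norm (v' - v))\<^sup>2 + \<mu> / 2 * (norm x')\<^sup>2 + (norm G)\<^sup>2 / (2 * L\<^sub>g) + D'
      + (norm v')\<^sup>2 / (2 * L\<^sub>f) \<le> ?E"
    using coupling[of "y' - y" "x' - x"] coupling'[of "v' - v" "x' - x"] E' G z'
    unfolding steps(1) halves abs_le_iff by linarith
  \<comment> \<open>The coefficients are 1/2 + 1/8 + 1/8 = 3/4, 4 + 2 = 6 and 8 + 4 = 12; the last
    uses \<open>D''\<close> to turn the gradient part of the cross term into a Bregman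
    distance.\<close>
  have P_upper: "?P \<le> 3 / (4 * \<eta>) * (norm x')\<^sup>2 + 6 * \<eta> * (N\<^sup>2 * (norm y')\<^sup>2)
      + 12 * (L\<^sub>f * \<eta>) * D'"
    using coupling[of y' x'] coupling'[of v' x'] D'' unfolding steps halves(1,3) mult.commute[of L\<^sub>f \<eta>] abs_le_iff by linarith
  show "0 \<le> ?P"
  proof -
    have "0 \<le> (norm x')\<^sup>2 / (4 * \<eta>) + 2 * \<eta> * (N\<^sup>2 * (norm y')\<^sup>2) + 2 * \<eta> * (norm v')\<^sup>2"
      using pos by simp
    also have "\<dots> \<le> ?P"
      using coupling[of y' x'] coupling'[of v' x'] D'' unfolding steps halves abs_le_iff by linarith
    finally show ?thesis .
  qed
  \<comment> \<open>The primal update is solved for \<open>T y'\<close>, leaving five vectors whose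
    squared norms all appear in \<open>E_lower\<close>.\<close>
  have "T (y' + s *\<^sub>R (y' - y)) + (v' + s' *\<^sub>R (v' - v)) + G = (- 1 / \<eta>) *\<^sub>R (x' - x)"
    using arg_cong[OF X, of "\<lambda>u. (1 / \<eta>) *\<^sub>R u"] pos by (simp add: algebra_simps)
  then have "T y' = (- 1 / \<eta>) *\<^sub>R (x' - x) + (- s) *\<^sub>R T (y' - y) + (- s') *\<^sub>R (v' - v)
      + (- 1) *\<^sub>R v' + (- 1) *\<^sub>R G"
    unfolding linear_add[OF lin] linear_scale[OF lin] by (simp add: algebra_simps)
  then have "(norm (T y'))\<^sup>2 \<le> 5 * ((norm (x' - x))\<^sup>2 / \<eta>\<^sup>2 + (norm (T (y' - y)))\<^sup>2
      + (norm (v' - v))\<^sup>2 + (norm v')\<^sup>2 + (norm G)\<^sup>2)"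
    using norm_sum5_sq[of "(- 1 / \<eta>) *\<^sub>R (x' - x)" "(- s) *\<^sub>R T (y' - y)"
        "(- s') *\<^sub>R (v' - v)" "(- 1) *\<^sub>R v'" "(- 1) *\<^sub>R G"] s
    by (simp add: power_mult_distrib power_divide)
  also have "(norm (T (y' - y)))\<^sup>2 \<le> N\<^sup>2 * (norm (y' - y))\<^sup>2"
    using power_mono[OF T_bound, of _ 2] by (simp add: power_mult_distrib)
  finally have "\<kappa> * (norm y')\<^sup>2 \<le> 5 * ((norm (x' - x))\<^sup>2 / \<eta>\<^sup>2 + N\<^sup>2 * (norm (y' - y))\<^sup>2
      + (norm (v' - v))\<^sup>2 + (norm v')\<^sup>2 + (norm G)\<^sup>2)"
    using coercive by simp
  moreover have "N\<^sup>2 * q \<le> 5 * (N\<^sup>2 / \<kappa>) * w" if "\<kappa> * q \<le> 5 * w" for q w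
    using mult_left_mono[OF that, of "N\<^sup>2 / \<kappa>"] pos by (simp add: mult_ac)
  ultimately have "N\<^sup>2 * (norm y')\<^sup>2 \<le> 5 * (N\<^sup>2 / \<kappa>) * ((norm (x' - x))\<^sup>2 / \<eta>\<^sup>2 + N\<^sup>2 * (norm (y' - y))\<^sup>2
      + (norm (v' - v))\<^sup>2 + (norm v')\<^sup>2 + (norm G)\<^sup>2)"
    by blast
  moreover have "0 \<le> D'"
    using pos by (intro order_trans[OF _ D']) simp
  moreover have "N\<^sup>2 / \<kappa> \<ge> 1" using pos by simp
  ultimately have "?P \<le> 120 * (A + N\<^sup>2 / \<kappa>) * ((norm (x' - x))\<^sup>2 / (4 * \<eta>)
      + 2 * \<eta> * (N\<^sup>2 * (norm (y' - y))\<^sup>2) + 2 * \<eta> * (norm (v' - v))\<^sup>2 + \<mu> / 2 * (norm x')\<^sup>2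
      + (norm G)\<^sup>2 / (2 * L\<^sub>g) + D' + (norm v')\<^sup>2 / (2 * L\<^sub>f))"
    by (intro order_trans[OF P_upper rate_estimate[OF pos(1-5) _ A]]) simp_all
  also have "\<dots> \<le> 120 * (A + N\<^sup>2 / \<kappa>) * ?E"
    using pos by (intro mult_left_mono[OF E_lower]) auto
  finally show "?P \<le> 120 * (A + N\<^sup>2 / \<kappa>) * ?E" .
qed

section \<open>The constrained problem, its solution and the four algorithms\<close>

locale affine_constrained_problem =
  fixes d\<^sub>x d\<^sub>y :: nat and f g :: "fseq \<Rightarrow> real" and K :: "fseq \<Rightarrow> fseq" and b :: fseq
    and L\<^sub>f L\<^sub>g \<mu>\<^sub>g :: real and xs ys zs :: fseq
  assumes L\<^sub>f_pos: "L\<^sub>f > 0" and f_convex: "convex_on (Rn d\<^sub>x) f" and f_smooth: "smooth_on (Rn d\<^sub>x) L\<^sub>f f"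
    and \<mu>\<^sub>g_le: "\<mu>\<^sub>g \<le> L\<^sub>g" and \<mu>\<^sub>g_pos: "\<mu>\<^sub>g > 0" and g_smooth: "smooth_on (Rn d\<^sub>x) L\<^sub>g g"
    and g_convex: "strongly_convex_on (Rn d\<^sub>x) \<mu>\<^sub>g g"
    and K: "K \<in> lin_ops d\<^sub>x d\<^sub>y" and K_nonzero: "K \<noteq> (\<lambda>_. 0)"
    and lambda_pos: "lambda_min_pos K > 0" and b: "b \<in> range K"
    and opt: "optimality_system (Rn d\<^sub>x) f g K b xs ys zs"
begin

abbreviation "Gf \<equiv> gradient (Rn d\<^sub>x) f"
abbreviation "Gg \<equiv> gradient (Rn d\<^sub>x) g"
abbreviation "T \<equiv> adjoint K"
abbreviation "\<sigma> \<equiv> lambda_min_pos K"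

sublocale f: smooth_convex "Rn d\<^sub>x" f Gf L\<^sub>f
  by (rule smooth_convex_Rn[OF f_smooth f_convex L\<^sub>f_pos])

sublocale g: smooth_convex "Rn d\<^sub>x" g Gg L\<^sub>g
  using g_convex \<mu>\<^sub>g_pos \<mu>\<^sub>g_le by (intro smooth_convex_Rn[OF g_smooth]) (auto simp: strongly_convex_on_def)

lemma linear_K: "linear K" using K by (simp add: lin_ops_def)

lemma adj: "K x \<bullet> y = x \<bullet> T y" by (rule adjoint_lin_ops[OF K])

lemma T_mem: "T y \<in> Rn d\<^sub>x" by (rule adjoint_lin_ops[OF K])

lemma linear_T: "linear T"
proof
  show "T (u + v) = T u + T v" for u v
    by (rule vector_eq_ldot[THEN iffD1]) (simp add: inner_add_right adj[symmetric])
  show "T (c *\<^sub>R u) = c *\<^sub>R T u" for c u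
    by (rule vector_eq_ldot[THEN iffD1]) (simp add: adj[symmetric])
qed

lemma K_bound: "norm (K u) \<le> onorm K * norm u"
  by (rule onorm[OF bounded_linear_lin_ops[OF K]])

text \<open>The squared norm of \<open>T u\<close> equals \<open>K (T u) \<bullet> u\<close>;
  Cauchy-Schwarz and \<open>K_bound\<close> leave one factor \<open>norm (T u)\<close> to
  cancel.\<close>

lemma T_bound: "norm (T u) \<le> onorm K * norm u"
proof (cases "T u = 0")
  case False
  have "(norm (T u))\<^sup>2 = K (T u) \<bullet> u" by (simp add: adj dot_square_norm)
  also have "\<dots> \<le> norm (K (T u)) * norm u" by (rule norm_cauchy_schwarz)
  also have "\<dots> \<le> onorm K * norm (T u) * norm u" by (intro mult_right_mono K_bound) simp
  finally show ?thesis using False by (simp add: power2_eq_square mult_ac)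
qed (simp add: onorm_pos_le[OF bounded_linear_lin_ops[OF K]])

lemma onorm_pos: "onorm K > 0"
  using K_nonzero by (simp add: onorm_pos_lt[OF bounded_linear_lin_ops[OF K]] fun_eq_iff)

lemma coercive: "u \<in> range K \<Longrightarrow> \<sigma> * (norm u)\<^sup>2 \<le> (norm (T u))\<^sup>2"
proof (cases "u = 0")
  case False
  assume "u \<in> range K"
  then have "\<sigma> \<le> (norm (T u))\<^sup>2 / (norm u)\<^sup>2"
    unfolding lambda_min_pos_def using False
    by (intro cINF_lower bdd_belowI2[of _ 0]) auto
  then show ?thesis using False by (simp add: field_simps)
qed simp

text \<open>Any nonzero \<open>K u\<close> squeezes \<open>\<sigma>\<close> between
  \<open>coercive\<close> and \<open>T_bound\<close>. This makes the condition ratio at least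
  1.\<close>

lemma lambda_le: "\<sigma> \<le> (onorm K)\<^sup>2"
proof -
  obtain u where u: "K u \<noteq> 0" using K_nonzero by auto
  have "\<sigma> * (norm (K u))\<^sup>2 \<le> (norm (T (K u)))\<^sup>2" by (rule coercive) simp
  also have "\<dots> \<le> (onorm K)\<^sup>2 * (norm (K u))\<^sup>2"
    using power_mono[OF T_bound, of _ 2] by (simp add: power_mult_distrib)
  finally show ?thesis using u by simp
qed

lemma range_K: "subspace (range K)"
  using linear_subspace_image[OF linear_K subspace_UNIV] .

lemma solution: "xs \<in> Rn d\<^sub>x" "ys \<in> range K" "K xs = b" "zs = xs"
  "Gg xs + T ys + Gf xs = 0"
  using opt by (auto simp: optimality_system_def)

text \<open>The right-hand side is the sum of the two Bregman distances between \<open>x\<close> and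
  \<open>y\<close>: strong convexity bounds one, smoothness the other.\<close>

lemma g_monotone:
  assumes "x \<in> Rn d\<^sub>x" "y \<in> Rn d\<^sub>x"
  shows "\<mu>\<^sub>g / 2 * (norm (x - y))\<^sup>2 + (norm (Gg x - Gg y))\<^sup>2 / (2 * L\<^sub>g) \<le> (Gg x - Gg y) \<bullet> (x - y)"
  using g.strongly_convex_D[OF g_convex assms] g.D_lower[OF assms(2,1)] g.D_sym[of x y]
  by (simp add: inner_commute norm_minus_commute)

text \<open>Of the two Bregman distances in \<open>f.D_sym\<close> one is kept, since it occurs in
  the Lyapunov function, and the other is traded for a squared gradient difference.\<close>

lemma f_monotone:
  assumes "x \<in> Rn d\<^sub>x" "y \<in> Rn d\<^sub>x"
  shows "f.D x y + (norm (Gf x - Gf y))\<^sup>2 / (2 * L\<^sub>f) \<le> (Gf x - Gf y) \<bullet> (x - y)"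
  using f.D_lower[OF assms(2,1)] f.D_sym[of x y] by (simp add: inner_commute norm_minus_commute)

text \<open>Subtracting the two stationarity equations and pairing with \<open>x - xs\<close>
  removes the dual term, as both points are feasible; strong monotonicity then gives
  \<open>x = xs\<close>. What remains is \<open>T (y - ys) = 0\<close>, and \<open>T\<close> is
  injective on the range of \<open>K\<close> by \<open>coercive\<close>.\<close>

lemma optimality_unique:
  assumes "optimality_system (Rn d\<^sub>x) f g K b x y z"
  shows "(x, y, z) = (xs, ys, zs)"
proof -
  have o: "x \<in> Rn d\<^sub>x" "y \<in> range K" "K x = b" "z = x" "Gg x + T y + Gf x = 0"
    using assms by (auto simp: optimality_system_def)
  have "(Gg x - Gg xs) + T (y - ys) + (Gf x - Gf xs)
      = (Gg x + T y + Gf x) - (Gg xs + T ys + Gf xs)"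
    by (simp add: linear_diff[OF linear_T])
  then have eq: "(Gg x - Gg xs) + T (y - ys) + (Gf x - Gf xs) = 0"
    unfolding o solution by simp
  have "T (y - ys) \<bullet> (x - xs) = 0"
    using adj[of "x - xs" "y - ys"] o solution by (simp add: linear_diff[OF linear_K] inner_commute)
  then have "(Gg x - Gg xs) \<bullet> (x - xs) + (Gf x - Gf xs) \<bullet> (x - xs) = 0"
    using arg_cong[OF eq, of "\<lambda>u. u \<bullet> (x - xs)"] by (simp add: inner_add_left)
  moreover have "0 \<le> (norm (Gf x - Gf xs))\<^sup>2 / (2 * L\<^sub>f)" "0 \<le> (norm (Gg x - Gg xs))\<^sup>2 / (2 * L\<^sub>g)"
    using f.L_pos g.L_pos by simp_all
  ultimately have "\<mu>\<^sub>g / 2 * (norm (x - xs))\<^sup>2 \<le> 0"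
    using g_monotone[OF o(1) solution(1)] f_monotone[OF o(1) solution(1)]
      f.D_nonneg[OF o(1) solution(1)] by linarith
  then have x: "x = xs" using \<mu>\<^sub>g_pos by (simp add: mult_le_0_iff)
  then have "T (y - ys) = 0" using eq by simp
  then have "\<sigma> * (norm (y - ys))\<^sup>2 \<le> 0"
    using coercive[of "y - ys"] o solution range_K by (simp add: subspace_diff)
  then have "y = ys" using lambda_pos by (simp add: mult_le_0_iff)
  with x o solution show ?thesis by simp
qed

text \<open>The first summand of the complexity bound; for the prescribed primal stepsize it equals
  \<open>1 / (\<eta>\<^sub>x * \<mu>\<^sub>g)\<close>.\<close>

definition A :: real
  where "A = sqrt ((L\<^sub>f + L\<^sub>g) / \<mu>\<^sub>g) * (onorm K / sqrt \<sigma>)"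

lemma A_pos: "A > 0"
  using f.L_pos g.L_pos \<mu>\<^sub>g_pos onorm_pos lambda_pos by (simp add: A_def)

lemma A_sq: "\<mu>\<^sub>g * A\<^sup>2 = (L\<^sub>f + L\<^sub>g) * ((onorm K)\<^sup>2 / \<sigma>)"
  using f.L_pos g.L_pos \<mu>\<^sub>g_pos onorm_pos lambda_pos
  by (simp add: A_def power_mult_distrib power_divide)

text \<open>Since $\lambda_{\min}^+ \le \|K\|^2$, the second term always attains the minimum that
  defines the stepsize.\<close>

lemma stepsize:
  assumes "\<eta> = min (1 / sqrt (L\<^sub>f * \<mu>\<^sub>g)) (sqrt (\<sigma> / (onorm K)\<^sup>2) * (1 / sqrt ((L\<^sub>g + L\<^sub>f) * \<mu>\<^sub>g)))"
  shows "\<eta> > 0" "\<eta> * \<mu>\<^sub>g * A = 1"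
proof -
  have "sqrt (\<sigma> / (onorm K)\<^sup>2) * (1 / sqrt ((L\<^sub>g + L\<^sub>f) * \<mu>\<^sub>g)) \<le> 1 * (1 / sqrt (L\<^sub>f * \<mu>\<^sub>g))"
    using lambda_le lambda_pos onorm_pos f.L_pos g.L_pos \<mu>\<^sub>g_pos
    by (intro mult_mono divide_left_mono) auto
  then have \<eta>: "\<eta> = sqrt \<sigma> / onorm K * (1 / sqrt ((L\<^sub>g + L\<^sub>f) * \<mu>\<^sub>g))"
    using assms onorm_pos by (simp add: real_sqrt_divide)
  then show "\<eta> > 0" using onorm_pos lambda_pos f.L_pos g.L_pos \<mu>\<^sub>g_pos by simp
  have "\<eta> * \<mu>\<^sub>g * A = \<mu>\<^sub>g / sqrt ((L\<^sub>f + L\<^sub>g) * \<mu>\<^sub>g) * sqrt ((L\<^sub>f + L\<^sub>g) / \<mu>\<^sub>g)"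
    using onorm_pos lambda_pos unfolding \<eta> A_def by (simp add: add.commute)
  also have "\<dots> = \<mu>\<^sub>g / (sqrt \<mu>\<^sub>g * sqrt \<mu>\<^sub>g)"
    using f.L_pos g.L_pos by (simp add: real_sqrt_mult real_sqrt_divide)
  finally show "\<eta> * \<mu>\<^sub>g * A = 1" using \<mu>\<^sub>g_pos by simp
qed

text \<open>For sign +1 the primal update extrapolates and the companion update uses the old
  \<open>x\<close>; for sign -1 the roles are exchanged. As relations between consecutive iterates
  the updates do not depend on the order in which they are computed.\<close>

lemma unified_step:
  assumes "generated_by alg (Rn d\<^sub>x) f g K b \<eta>\<^sub>x \<eta>\<^sub>y \<eta>\<^sub>z x y z"
  shows "is_prox (Rn d\<^sub>x) (\<lambda>w. \<eta>\<^sub>x * g w)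
      (x k - \<eta>\<^sub>x *\<^sub>R T (y (Suc k) + sign_y alg *\<^sub>R (y (Suc k) - y k))
        - \<eta>\<^sub>x *\<^sub>R (Gf (z (Suc k)) + sign_z alg *\<^sub>R (Gf (z (Suc k)) - Gf (z k)))) (x (Suc k))"
    and "y (Suc k) = y k + \<eta>\<^sub>y *\<^sub>R (K (x (Suc k) - sign_y alg *\<^sub>R (x (Suc k) - x k)) - b)"
    and "z (Suc k) = (1 / (1 + \<eta>\<^sub>z)) *\<^sub>R z k
      + (\<eta>\<^sub>z / (1 + \<eta>\<^sub>z)) *\<^sub>R (x (Suc k) - sign_z alg *\<^sub>R (x (Suc k) - x k))"
proof -
  have "a + 1 *\<^sub>R (a - c) = 2 *\<^sub>R a - c" "a + (- 1) *\<^sub>R (a - c) = c"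
    "a - 1 *\<^sub>R (a - c) = c" "a - (- 1) *\<^sub>R (a - c) = 2 *\<^sub>R a - c" for a c :: fseq
    by (simp_all add: scaleR_2)
  note unfold = generated_by.simps sign_y.simps sign_z.simps this
  show "is_prox (Rn d\<^sub>x) (\<lambda>w. \<eta>\<^sub>x * g w)
      (x k - \<eta>\<^sub>x *\<^sub>R T (y (Suc k) + sign_y alg *\<^sub>R (y (Suc k) - y k))
        - \<eta>\<^sub>x *\<^sub>R (Gf (z (Suc k)) + sign_z alg *\<^sub>R (Gf (z (Suc k)) - Gf (z k)))) (x (Suc k))"
    and "y (Suc k) = y k + \<eta>\<^sub>y *\<^sub>R (K (x (Suc k) - sign_y alg *\<^sub>R (x (Suc k) - x k)) - b)"
    and "z (Suc k) = (1 / (1 + \<eta>\<^sub>z)) *\<^sub>R z k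
      + (\<eta>\<^sub>z / (1 + \<eta>\<^sub>z)) *\<^sub>R (x (Suc k) - sign_z alg *\<^sub>R (x (Suc k) - x k))"
    using assms by (cases alg; simp only: unfold; blast)+
qed

context
  fixes alg :: algorithm and \<eta>\<^sub>x \<eta>\<^sub>y \<eta>\<^sub>z :: real and x y z :: "nat \<Rightarrow> fseq"
  assumes \<eta>\<^sub>x: "\<eta>\<^sub>x > 0" "\<eta>\<^sub>x * \<mu>\<^sub>g * A = 1"
    and \<eta>\<^sub>y: "\<eta>\<^sub>y = 1 / (8 * (onorm K)\<^sup>2 * \<eta>\<^sub>x)" and \<eta>\<^sub>z: "\<eta>\<^sub>z = 1 / (8 * L\<^sub>f * \<eta>\<^sub>x)"
    and init: "x 0 \<in> Rn d\<^sub>x" "y 0 \<in> range K" "z 0 \<in> Rn d\<^sub>x"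
    and gen: "generated_by alg (Rn d\<^sub>x) f g K b \<eta>\<^sub>x \<eta>\<^sub>y \<eta>\<^sub>z x y z"
begin

text \<open>Keeping \<open>y k\<close> in the range of \<open>K\<close> is what makes
  \<open>coercive\<close> applicable to the dual error at every step.\<close>

lemma iterates_mem: "x k \<in> Rn d\<^sub>x \<and> y k \<in> range K \<and> z k \<in> Rn d\<^sub>x"
proof (induction k)
  case (Suc k)
  note step = unified_step[OF gen, of k]
  have x: "x (Suc k) \<in> Rn d\<^sub>x" using step(1) by (simp add: is_prox_def is_arg_min_def)
  moreover have "y (Suc k) \<in> range K" unfolding step(2) using Suc b range_K
    by (intro subspace_add subspace_scale subspace_diff) auto
  moreover have "z (Suc k) \<in> Rn d\<^sub>x" unfolding step(3) using Suc x
    by (intro subspace_add subspace_scale subspace_diff subspace_Rn) auto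
  ultimately show ?case by simp
qed (use init in simp)

abbreviation "\<Psi> k \<equiv> lyapunov alg (Rn d\<^sub>x) f K \<eta>\<^sub>x \<eta>\<^sub>y \<eta>\<^sub>z xs ys zs (x k) (y k) (z k)"

text \<open>The iterates are recentred at the solution so that \<open>energy_identity\<close> and
  \<open>energy_decrease\<close> apply to the errors.\<close>

lemma lyapunov_step:
  "0 \<le> \<Psi> (Suc k)"
  "\<Psi> (Suc k) \<le> 120 * (A + (onorm K)\<^sup>2 / \<sigma>) * (\<Psi> k - \<Psi> (Suc k))"
proof -
  let ?x = "x k - xs" and ?x' = "x (Suc k) - xs" and ?y = "y k - ys" and ?y' = "y (Suc k) - ys"
  let ?z = "z k - xs" and ?z' = "z (Suc k) - xs"
  let ?v = "Gf (z k) - Gf xs" and ?v' = "Gf (z (Suc k)) - Gf xs"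
  let ?G = "Gg (x (Suc k)) - Gg xs" and ?s = "sign_y alg" and ?s' = "sign_z alg"
  note mem = iterates_mem[of k] iterates_mem[of "Suc k"] solution
  note step = unified_step[OF gen, of k]
  have pos: "\<eta>\<^sub>y > 0" "\<eta>\<^sub>z > 0" using \<eta>\<^sub>x onorm_pos f.L_pos by (simp_all add: \<eta>\<^sub>y \<eta>\<^sub>z)
  have s: "\<bar>?s\<bar> = 1" "\<bar>?s'\<bar> = 1" by (cases alg; simp)+
  define \<tau> where "\<tau> = T (y (Suc k) + ?s *\<^sub>R (y (Suc k) - y k))"
  define \<zeta> where "\<zeta> = Gf (z (Suc k)) + ?s' *\<^sub>R (Gf (z (Suc k)) - Gf (z k))"
  have "x k - \<eta>\<^sub>x *\<^sub>R \<tau> - \<eta>\<^sub>x *\<^sub>R \<zeta> \<in> Rn d\<^sub>x"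
    unfolding \<tau>_def \<zeta>_def using mem
    by (intro subspace_diff subspace_add subspace_scale subspace_Rn T_mem f.G_mem) auto
  from g.is_prox_eq(2)[OF step(1)[folded \<tau>_def \<zeta>_def] this]
  \<comment> \<open>The subtracted bracket is zero by stationarity; it turns every term into an
    error.\<close>
  have "x k - x (Suc k) = \<eta>\<^sub>x *\<^sub>R (\<tau> + \<zeta> + Gg (x (Suc k)) - (Gg xs + T ys + Gf xs))"
    unfolding solution(5) by (simp add: algebra_simps)
  moreover have "\<tau> - T ys = T (?y' + ?s *\<^sub>R (?y' - ?y))"
    unfolding \<tau>_def linear_diff[OF linear_T, symmetric] by (simp add: algebra_simps)
  then have "\<tau> + \<zeta> + Gg (x (Suc k)) - (Gg xs + T ys + Gf xs)
      = T (?y' + ?s *\<^sub>R (?y' - ?y)) + (?v' + ?s' *\<^sub>R (?v' - ?v)) + ?G"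
    by (simp add: \<zeta>_def algebra_simps)
  ultimately have X: "?x - ?x'
      = \<eta>\<^sub>x *\<^sub>R (T (?y' + ?s *\<^sub>R (?y' - ?y)) + (?v' + ?s' *\<^sub>R (?v' - ?v)) + ?G)"
    by simp
  have "K (?x' - ?s *\<^sub>R (?x' - ?x)) = K (x (Suc k) - ?s *\<^sub>R (x (Suc k) - x k) - xs)"
    by (simp add: algebra_simps)
  then have Y: "?y' - ?y = \<eta>\<^sub>y *\<^sub>R K (?x' - ?s *\<^sub>R (?x' - ?x))"
    using step(2) by (simp add: linear_diff[OF linear_K, of _ xs] solution)
  \<comment> \<open>Clearing the denominator exhibits the averaging as an implicit step, with
    \<open>z (Suc k)\<close> on the right-hand side as well.\<close>
  have "(1 + \<eta>\<^sub>z) *\<^sub>R z (Suc k) = z k + \<eta>\<^sub>z *\<^sub>R (x (Suc k) - ?s' *\<^sub>R (x (Suc k) - x k))"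
    using pos by (subst step(3)) (simp add: scaleR_add_right)
  then have Z: "?z' - ?z = \<eta>\<^sub>z *\<^sub>R (?x' - ?s' *\<^sub>R (?x' - ?x) - ?z')"
    by (simp add: algebra_simps)
  \<comment> \<open>The Bregman distances to \<open>xs\<close> telescope; the leftover
    \<open>f.D (z k) (z (Suc k))\<close> controls the increment of the gradient.\<close>
  have D: "(?z' - ?z) \<bullet> ?v' = f.D (z (Suc k)) xs - f.D (z k) xs + f.D (z k) (z (Suc k))"
    using f.three_point[of "z k" "z (Suc k)" xs]
    by (simp add: inner_diff_left inner_diff_right f.D_def algebra_simps inner_commute)
  have \<Psi>: "\<Psi> j = 1 / (2 * \<eta>\<^sub>x) * (norm (x j - xs))\<^sup>2 + 1 / (2 * \<eta>\<^sub>y) * (norm (y j - ys))\<^sup>2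
      + 1 / \<eta>\<^sub>z * f.D (z j) xs + ?s * ((y j - ys) \<bullet> K (x j - xs))
      + ?s' * ((Gf (z j) - Gf xs) \<bullet> (x j - xs))" for j
    by (simp add: lyapunov_def bregman_def f.D_def solution)
  have D': "(norm ?v')\<^sup>2 / (2 * L\<^sub>f) \<le> f.D (z (Suc k)) xs"
    using f.D_lower mem by blast
  have E: "(norm (?v' - ?v))\<^sup>2 / (2 * L\<^sub>f) \<le> f.D (z k) (z (Suc k))"
    using f.D_lower[of "z k" "z (Suc k)"] mem by (simp add: norm_minus_commute)
  have z': "f.D (z (Suc k)) xs + (norm ?v')\<^sup>2 / (2 * L\<^sub>f) \<le> ?v' \<bullet> ?z'"
    using f_monotone mem by blast
  have G: "\<mu>\<^sub>g / 2 * (norm ?x')\<^sup>2 + (norm ?G)\<^sup>2 / (2 * L\<^sub>g) \<le> ?G \<bullet> ?x'"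
    using g_monotone mem by blast
  have "\<sigma> * (norm ?y')\<^sup>2 \<le> (norm (T ?y'))\<^sup>2"
    using mem range_K by (intro coercive subspace_diff) auto
  note decrease = energy_decrease[OF linear_T K_bound T_bound this \<eta>\<^sub>x(1) \<mu>\<^sub>g_pos L\<^sub>f_pos g.L_pos A_pos
      onorm_pos lambda_pos lambda_le \<eta>\<^sub>x(2) A_sq \<eta>\<^sub>y \<eta>\<^sub>z s X D' E z' G]
  note identity = energy_identity[OF linear_K adj \<eta>\<^sub>x(1) pos X Y Z D]
  \<comment> \<open>By the identity, the decrease \<open>e\<close> is exactly the drop of the
    Lyapunov function.\<close>
  have combine: "q \<le> c * (p - q)" if "q \<le> c * e" "q = p - e" for p q c e :: real
    using that by simp
  show "0 \<le> \<Psi> (Suc k)" unfolding \<Psi> by (rule decrease(2))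
  show "\<Psi> (Suc k) \<le> 120 * (A + (onorm K)\<^sup>2 / \<sigma>) * (\<Psi> k - \<Psi> (Suc k))"
    by (rule combine[OF decrease(1)[folded \<Psi>] identity[folded \<Psi>]])
qed

end

end

section \<open>From the one-step estimate to the iteration count\<close>

text \<open>The step inequality contracts by \<open>c / (c + 1) = 1 - 1 / (c + 1)\<close>, which is
  at most \<open>exp (- 1 / R)\<close>; iterating and taking logarithms gives the count.\<close>

lemma geometric_decay:
  fixes \<Psi> :: "nat \<Rightarrow> real"
  assumes nonneg: "\<And>k. 0 \<le> \<Psi> (Suc k)" and step: "\<And>k. \<Psi> (Suc k) \<le> c * (\<Psi> k - \<Psi> (Suc k))"
    and R: "c > 0" "c + 1 \<le> R" and "\<epsilon> > 0" and k: "real k \<ge> R * ln (1 / \<epsilon>)"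
  shows "\<Psi> k \<le> \<epsilon> * \<Psi> 0"
proof -
  \<comment> \<open>Nonnegativity is assumed from index 1 on; at index 0 it follows because the
    first step cannot increase the value.\<close>
  have "0 \<le> c * (\<Psi> 0 - \<Psi> 1)" using nonneg[of 0] step[of 0] by simp
  then have \<Psi>0: "0 \<le> \<Psi> 0" using nonneg[of 0] R(1) by (simp add: zero_le_mult_iff)
  then have \<Psi>_nonneg: "0 \<le> \<Psi> j" for j using nonneg by (cases j) auto
  have decay: "\<Psi> j \<le> exp (- real j / R) * \<Psi> 0" for j
  proof (induction j)
    case (Suc j)
    have "\<Psi> (Suc j) \<le> c / (c + 1) * \<Psi> j"
      using step[of j] R(1) by (simp add: field_simps)
    also have "c / (c + 1) \<le> exp (- 1 / R)"
    proof -
      have "c / (c + 1) = 1 - 1 / (c + 1)" using R by (simp add: field_simps)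
      also have "\<dots> \<le> 1 + (- 1 / R)" using R by (simp add: frac_le)
      also have "\<dots> \<le> exp (- 1 / R)" by (rule exp_ge_add_one_self)
      finally show ?thesis .
    qed
    finally have "\<Psi> (Suc j) \<le> exp (- 1 / R) * \<Psi> j" using \<Psi>_nonneg by (simp add: mult_right_mono)
    also have "\<dots> \<le> exp (- 1 / R) * (exp (- real j / R) * \<Psi> 0)"
      using Suc by simp
    also have "\<dots> = exp (- real (Suc j) / R) * \<Psi> 0"
      by (simp add: mult.assoc[symmetric] exp_add[symmetric] add_divide_distrib diff_divide_distrib)
    finally show ?case .
  qed simp
  have "- real k / R \<le> ln \<epsilon>"
    using k R \<open>\<epsilon> > 0\<close> by (simp add: ln_div field_simps)
  then have "exp (- real k / R) \<le> \<epsilon>" using \<open>\<epsilon> > 0\<close> by (metis exp_le_cancel_iff exp_ln)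
  then show ?thesis using decay[of k] \<Psi>0 by (meson mult_right_mono order_trans)
qed

theorem corollary4:
  "\<exists>C::real. C > 0 \<and>
    (\<forall>(d\<^sub>x::nat) (d\<^sub>y::nat) (f :: fseq \<Rightarrow> real) (g :: fseq \<Rightarrow> real) (K :: fseq \<Rightarrow> fseq) (b :: fseq)
      (L\<^sub>f::real) (L\<^sub>g::real) (\<mu>\<^sub>g::real) (xs :: fseq) (ys :: fseq) (zs :: fseq).
      L\<^sub>f > 0 \<and> convex_on (Rn d\<^sub>x) f \<and> smooth_on (Rn d\<^sub>x) L\<^sub>f f \<and>
      L\<^sub>g \<ge> \<mu>\<^sub>g \<and> \<mu>\<^sub>g > 0 \<and> smooth_on (Rn d\<^sub>x) L\<^sub>g g \<and> strongly_convex_on (Rn d\<^sub>x) \<mu>\<^sub>g g \<and>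
      K \<in> lin_ops d\<^sub>x d\<^sub>y \<and> K \<noteq> (\<lambda>_. 0) \<and> lambda_min_pos K > 0 \<and> b \<in> range K \<and>
      optimality_system (Rn d\<^sub>x) f g K b xs ys zs
      \<longrightarrow>
      (\<forall>x' y' z'. optimality_system (Rn d\<^sub>x) f g K b x' y' z' \<longrightarrow> (x', y', z') = (xs, ys, zs)) \<and>
      (\<forall>(alg::algorithm) (\<eta>\<^sub>x::real) (\<eta>\<^sub>y::real) (\<eta>\<^sub>z::real)
        (x :: nat \<Rightarrow> fseq) (y :: nat \<Rightarrow> fseq) (z :: nat \<Rightarrow> fseq) (\<Psi> :: nat \<Rightarrow> real).
        \<eta>\<^sub>x = min (1 / sqrt (L\<^sub>f * \<mu>\<^sub>g))
                 (sqrt (lambda_min_pos K / (onorm K)\<^sup>2) * (1 / sqrt ((L\<^sub>g + L\<^sub>f) * \<mu>\<^sub>g))) \<and>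
        \<eta>\<^sub>y = 1 / (8 * (onorm K)\<^sup>2 * \<eta>\<^sub>x) \<and>
        \<eta>\<^sub>z = 1 / (8 * L\<^sub>f * \<eta>\<^sub>x) \<and>
        x 0 \<in> Rn d\<^sub>x \<and> y 0 \<in> range K \<and> z 0 \<in> Rn d\<^sub>x \<and>
        generated_by alg (Rn d\<^sub>x) f g K b \<eta>\<^sub>x \<eta>\<^sub>y \<eta>\<^sub>z x y z \<and>
        (\<forall>k. \<Psi> k = lyapunov alg (Rn d\<^sub>x) f K \<eta>\<^sub>x \<eta>\<^sub>y \<eta>\<^sub>z xs ys zs (x k) (y k) (z k))
        \<longrightarrow>
        (\<forall>\<epsilon>>0. \<forall>k::nat.
          real k \<ge> C * ((sqrt ((L\<^sub>f + L\<^sub>g) / \<mu>\<^sub>g) * (onorm K / sqrt (lambda_min_pos K))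
                          + (onorm K)\<^sup>2 / lambda_min_pos K) * ln (1 / \<epsilon>))
          \<longrightarrow> \<Psi> k \<le> \<epsilon> * \<Psi> 0)))"
  proof (intro exI[of _ 121] conjI allI impI)
  show "(121::real) > 0" by simp
next
  fix d\<^sub>x d\<^sub>y f g K b L\<^sub>f L\<^sub>g \<mu>\<^sub>g xs ys zs x' y' z'
  assume "L\<^sub>f > 0 \<and> convex_on (Rn d\<^sub>x) f \<and> smooth_on (Rn d\<^sub>x) L\<^sub>f f \<and>
      L\<^sub>g \<ge> \<mu>\<^sub>g \<and> \<mu>\<^sub>g > 0 \<and> smooth_on (Rn d\<^sub>x) L\<^sub>g g \<and> strongly_convex_on (Rn d\<^sub>x) \<mu>\<^sub>g g \<and>
      K \<in> lin_ops d\<^sub>x d\<^sub>y \<and> K \<noteq> (\<lambda>_. 0) \<and> lambda_min_pos K > 0 \<and> b \<in> range K \<and>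
      optimality_system (Rn d\<^sub>x) f g K b xs ys zs"
  then interpret affine_constrained_problem d\<^sub>x d\<^sub>y f g K b L\<^sub>f L\<^sub>g \<mu>\<^sub>g xs ys zs
    by unfold_locales auto
  assume "optimality_system (Rn d\<^sub>x) f g K b x' y' z'"
  then show "(x', y', z') = (xs, ys, zs)" by (rule optimality_unique)
next
  fix d\<^sub>x d\<^sub>y f g K b L\<^sub>f L\<^sub>g \<mu>\<^sub>g xs ys zs alg \<eta>\<^sub>x \<eta>\<^sub>y \<eta>\<^sub>z x y z \<Psi> and \<epsilon> :: real and k :: nat
  assume "L\<^sub>f > 0 \<and> convex_on (Rn d\<^sub>x) f \<and> smooth_on (Rn d\<^sub>x) L\<^sub>f f \<and>
      L\<^sub>g \<ge> \<mu>\<^sub>g \<and> \<mu>\<^sub>g > 0 \<and> smooth_on (Rn d\<^sub>x) L\<^sub>g g \<and> strongly_convex_on (Rn d\<^sub>x) \<mu>\<^sub>g g \<and>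
      K \<in> lin_ops d\<^sub>x d\<^sub>y \<and> K \<noteq> (\<lambda>_. 0) \<and> lambda_min_pos K > 0 \<and> b \<in> range K \<and>
      optimality_system (Rn d\<^sub>x) f g K b xs ys zs"
  then interpret affine_constrained_problem d\<^sub>x d\<^sub>y f g K b L\<^sub>f L\<^sub>g \<mu>\<^sub>g xs ys zs
    by unfold_locales auto
  assume *: "\<eta>\<^sub>x = min (1 / sqrt (L\<^sub>f * \<mu>\<^sub>g))
                 (sqrt (lambda_min_pos K / (onorm K)\<^sup>2) * (1 / sqrt ((L\<^sub>g + L\<^sub>f) * \<mu>\<^sub>g))) \<and>
        \<eta>\<^sub>y = 1 / (8 * (onorm K)\<^sup>2 * \<eta>\<^sub>x) \<and>
        \<eta>\<^sub>z = 1 / (8 * L\<^sub>f * \<eta>\<^sub>x) \<and>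
        x 0 \<in> Rn d\<^sub>x \<and> y 0 \<in> range K \<and> z 0 \<in> Rn d\<^sub>x \<and>
        generated_by alg (Rn d\<^sub>x) f g K b \<eta>\<^sub>x \<eta>\<^sub>y \<eta>\<^sub>z x y z \<and>
        (\<forall>k. \<Psi> k = lyapunov alg (Rn d\<^sub>x) f K \<eta>\<^sub>x \<eta>\<^sub>y \<eta>\<^sub>z xs ys zs (x k) (y k) (z k))"
    and \<epsilon>: "\<epsilon> > 0"
    and k: "real k \<ge> 121 * ((sqrt ((L\<^sub>f + L\<^sub>g) / \<mu>\<^sub>g) * (onorm K / sqrt (lambda_min_pos K))
                          + (onorm K)\<^sup>2 / lambda_min_pos K) * ln (1 / \<epsilon>))"
  let ?R = "A + (onorm K)\<^sup>2 / lambda_min_pos K"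
  have \<eta>: "\<eta>\<^sub>x > 0" "\<eta>\<^sub>x * \<mu>\<^sub>g * A = 1" using * stepsize by blast+
  have step: "0 \<le> \<Psi> (Suc j)" "\<Psi> (Suc j) \<le> 120 * ?R * (\<Psi> j - \<Psi> (Suc j))" for j
  proof -
    have \<Psi>: "\<Psi> j = lyapunov alg (Rn d\<^sub>x) f K \<eta>\<^sub>x \<eta>\<^sub>y \<eta>\<^sub>z xs ys zs (x j) (y j) (z j)" for j
      using * by blast
    show "0 \<le> \<Psi> (Suc j)" "\<Psi> (Suc j) \<le> 120 * ?R * (\<Psi> j - \<Psi> (Suc j))"
      unfolding \<Psi> using * by (intro lyapunov_step[OF \<eta>]; blast)+
  qed
  \<comment> \<open>With \<open>?R\<close> at least 1, \<open>120 * ?R + 1\<close> is at most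
    \<open>121 * ?R\<close>; this is the source of the constant 121.\<close>
  have "1 \<le> (onorm K)\<^sup>2 / lambda_min_pos K" using lambda_le lambda_pos by simp
  with A_pos have R: "1 \<le> ?R" by simp
  show "\<Psi> k \<le> \<epsilon> * \<Psi> 0"
  proof (rule geometric_decay[of \<Psi> "120 * ?R" "121 * ?R"])
    show "121 * ?R * ln (1 / \<epsilon>) \<le> real k" using k unfolding A_def mult.assoc[of 121] .
  qed (use step R \<epsilon> in auto)
qed

end
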